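(* Let $d\ge1$, let $\alpha\in C(\mathbb{R}^d)$ satisfy $0<\alpha_{\min}\le\alpha(x)\le\alpha_{\max}<2$ for all $x\in\mathbb{R}^d$, and let $0<s\le 2$. Then there is a constant $c$, independent of the step-size $h>0$ and of $u$, such that for every $u\in\mathcal{B}^{s+\alpha_{\max}}(\mathbb{R}^d)$, with $u_h$ the restriction of $u$ to $h\mathbb{Z}^d$, $$\big\|(-\Delta)^{\alpha(x)/2}u(x)-(-\Delta_h)^{\alpha(x)/2}u_h(x)\big\|_{L_h^\infty}\le c\,h^{s}\,\|u\|_{\mathcal{B}^{s+\alpha_{\max}}(\mathbb{R}^d)} .$$
   Context: Fourier transform: $\mathcal{F}[u](\xi)=\int_{\mathbb{R}^d}e^{-\mathbf{i}\xi\cdot x}u(x)\,dx$, with inverse $\mathcal{F}^{-1}[\hat u](x)=\frac{1}{(2\pi)^d}\int_{\mathbb{R}^d}e^{\mathbf{i}\xi\cdot x}\hat u(\xi)\,d\xi$. Spectral Barron space: $\mathcal{B}^{t}(\mathbb{R}^d)=\{u\in L^1(\mathbb{R}^d):\int_{\mathbb{R}^d}(1+|\xi|^{t})|\mathcal{F}[u](\xi)|\,d\xi<\infty\}$, with norm $\|u\|_{\mathcal{B}^t(\mathbb{R}^d)}=\int_{\mathbb{R}^d}(1+|\xi|^{t})|\mathcal{F}[u](\xi)|\,d\xi$. Elements are identified with their continuous representatives, so that point values make sense. Variable-order fractional Laplacian: $$(-\Delta)^{\alpha(x)/2}u(x)=c_{d,\alpha(x)}\,\mathrm{P.V.}\int_{\mathbb{R}^d}\frac{u(x)-u(y)}{|x-y|^{d+\alpha(x)}}\,dy,\quad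 c_{d,\alpha(x)}=\frac{2^{\alpha(x)-1}\alpha(x)\Gamma((\alpha(x)+d)/2)}{\pi^{d/2}\Gamma(1-\alpha(x)/2)},$$ equivalently $\mathcal{F}^{-1}[|\xi|^{\alpha(x)}\mathcal{F}[u](\xi)](x)$. Discrete operator: for $h>0$ let $h\mathbb{Z}^d=\{jh:j\in\mathbb{Z}^d\}$ and $D_h=[-\pi/h,\pi/h]^d$. For $u_h:h\mathbb{Z}^d\to\mathbb{R}$, the semi-discrete Fourier transform is $\mathcal{F}_h[u_h](\xi)=h^d\sum_{x\in h\mathbb{Z}^d}e^{-\mathbf{i}\xi\cdot x}u_h(x)$, with inverse $\mathcal{F}_h^{-1}[g](x)=\frac{1}{(2\pi)^d}\int_{D_h}e^{\mathbf{i}\xi\cdot x}g(\xi)\,d\xi$. With $M_h(\xi)=\sum_{p=1}^d\frac{4}{h^2}\sin^2\big(\frac{\xi_p h}{2}\big)$, define for $x\in h\mathbb{Z}^d$ $$(-\Delta_h)^{\alpha(x)/2}u_h(x)=\mathcal{F}_h^{-1}\big[M_h(\xi)^{\alpha(x)/2}\mathcal{F}_h[u_h](\xi)\big](x).$$ Interchanging sum and integral, at $x_j=jh$ this reads $h^{-\alpha(x_j)}\sum_{k\in\mathbb{Z}^d}a_{k-j}^{(\alpha(x_j))}u_h(kh)$ with $a_n^{(\alpha)}=\frac{1}{(2\pi)^d}\int_{[-\pi,\pi]^d}e^{-\mathbf{i}\eta\cdot n}\big(\sum_{p=1}^d4\sin^2(\eta_p/2)\big)^{\alpha/2}d\eta$;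 the operator is understood through this formula if the series for $\mathcal{F}_h[u_h]$ is not absolutely convergent. Grid norm: for a bounded domain $\Omega\subset\mathbb{R}^d$, $\Omega_h=\Omega\cap h\mathbb{Z}^d$, and $\|v_h\|_{L_h^\infty}=\max_{x\in\Omega_h}|v_h(x)|$ for a grid function $v_h$ on $\Omega_h$ (the maximum over an empty set being $0$). *)

theory Defs
  imports "HOL-Analysis.Analysis"
begin

definition fourier :: "(real^'d \<Rightarrow> real) \<Rightarrow> real^'d \<Rightarrow> complex" where
  "fourier u \<xi> = (LINT x|lborel. exp (- (\<i> * complex_of_real (\<xi> \<bullet> x))) * complex_of_real (u x))"

text \<open>Elements of the space are identified with their continuous representatives; the continuity
  clause selects that representative.\<close>

definition barron :: "real \<Rightarrow> (real^'d \<Rightarrow> real) set" where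
  "barron t = {u. continuous_on UNIV u \<and> integrable lborel u \<and>
     integrable lborel (\<lambda>\<xi>. (1 + norm \<xi> powr t) * norm (fourier u \<xi>))}"

definition barron_norm :: "real \<Rightarrow> (real^'d \<Rightarrow> real) \<Rightarrow> real" where
  "barron_norm t u = (LINT \<xi>|lborel. (1 + norm \<xi> powr t) * norm (fourier u \<xi>))"

definition frac_const :: "nat \<Rightarrow> real \<Rightarrow> real" where
  "frac_const d a =
     2 powr (a - 1) * a * Gamma ((a + real d) / 2) / (pi powr (real d / 2) * Gamma (1 - a / 2))"

definition pv_integral :: "real^'d \<Rightarrow> (real^'d \<Rightarrow> real) \<Rightarrow> real" where
  "pv_integral x f = Lim (at_right 0) (\<lambda>\<epsilon>. LINT y:- ball x \<epsilon>|lborel. f y)"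

definition frac_lap :: "(real^'d \<Rightarrow> real) \<Rightarrow> (real^'d \<Rightarrow> real) \<Rightarrow> real^'d \<Rightarrow> real" where
  "frac_lap \<alpha> u x = frac_const CARD('d) (\<alpha> x) *
     pv_integral x (\<lambda>y. (u x - u y) / norm (x - y) powr (real CARD('d) + \<alpha> x))"

definition grid :: "real \<Rightarrow> (real^'d) set" where
  "grid h = range (\<lambda>j::int^'d. \<chi> p. real_of_int (j $ p) * h)"

text \<open>A grid function is a function on the whole space of which only the values on the grid
  are used.\<close>

definition fourier_h :: "real \<Rightarrow> (real^'d \<Rightarrow> real) \<Rightarrow> real^'d \<Rightarrow> complex" where
  "fourier_h h v \<xi> = complex_of_real (h ^ CARD('d)) *
     (\<Sum>\<^sub>\<infinity>x\<in>grid h. exp (- (\<i> * complex_of_real (\<xi> \<bullet> x))) * complex_of_real (v x))"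

definition freq_box :: "real \<Rightarrow> (real^'d) set" where
  "freq_box h = cbox (\<chi> p. - (pi / h)) (\<chi> p. pi / h)"

definition inv_fourier_h :: "real \<Rightarrow> (real^'d \<Rightarrow> complex) \<Rightarrow> real^'d \<Rightarrow> complex" where
  "inv_fourier_h h g x = complex_of_real (1 / (2 * pi) ^ CARD('d)) *
     (LINT \<xi>:freq_box h|lborel. exp (\<i> * complex_of_real (\<xi> \<bullet> x)) * g \<xi>)"

definition symbol_h :: "real \<Rightarrow> real^'d \<Rightarrow> real" where
  "symbol_h h \<xi> = (\<Sum>p\<in>UNIV. 4 / h\<^sup>2 * (sin (\<xi> $ p * h / 2))\<^sup>2)"

text \<open>The coefficient \<open>a_n\<close> of order \<open>a\<close>; it is only used for integer vectors \<open>n\<close>.\<close>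

definition frac_coeff :: "real \<Rightarrow> real^'d \<Rightarrow> complex" where
  "frac_coeff a n = complex_of_real (1 / (2 * pi) ^ CARD('d)) *
     (LINT \<eta>:cbox (\<chi> p. - pi) (\<chi> p. pi)|lborel. exp (- (\<i> * complex_of_real (\<eta> \<bullet> n))) *
        complex_of_real ((\<Sum>p\<in>UNIV. 4 * (sin (\<eta> $ p / 2))\<^sup>2) powr (a / 2)))"

text \<open>The Fourier definition applies if the series defining \<open>fourier_h\<close> converges absolutely.
  Otherwise the sum and the integral are interchanged; with \<open>x = j h\<close> and \<open>y = k h\<close> the index
  \<open>k - j\<close> of the coefficient is \<open>(y - x) / h\<close>.\<close>

definition frac_lap_h ::
  "real \<Rightarrow> (real^'d \<Rightarrow> real) \<Rightarrow> (real^'d \<Rightarrow> real) \<Rightarrow> real^'d \<Rightarrow> complex" where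
  "frac_lap_h h \<alpha> v x =
     (if \<forall>\<xi>. (\<lambda>y. norm (exp (- (\<i> * complex_of_real (\<xi> \<bullet> y))) * complex_of_real (v y)))
              summable_on grid h
      then inv_fourier_h h
             (\<lambda>\<xi>. complex_of_real (symbol_h h \<xi> powr (\<alpha> x / 2)) * fourier_h h v \<xi>) x
      else complex_of_real (h powr (- \<alpha> x)) *
             (\<Sum>\<^sub>\<infinity>y\<in>grid h. frac_coeff (\<alpha> x) ((y - x) /\<^sub>R h) * complex_of_real (v y)))"

definition grid_max_norm :: "real \<Rightarrow> (real^'d) set \<Rightarrow> (real^'d \<Rightarrow> complex) \<Rightarrow> real" where
  "grid_max_norm h \<Omega> v =
     (if \<Omega> \<inter> grid h = {} then 0 else Max ((\<lambda>x. norm (v x)) ` (\<Omega> \<inter> grid h)))"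

end

theory Submission
  imports Defs "HOL-Probability.Probability" "HOL-Real_Asymp.Real_Asymp"
begin

text \<open>
  Both operators are Fourier multipliers, and the theorem is a comparison of their symbols. For \<open>u\<close> in
  the Barron space, \<open>u\<close> and its transform are integrable and \<open>u\<close> is continuous, so Fourier inversion
  (\<open>fourier_inversion\<close>) writes every value of \<open>u\<close> as an absolutely convergent integral of plane waves
  \<open>exp (i \<xi> \<bullet> x)\<close>. A linear operator applied to \<open>u\<close> at \<open>x\<close> then multiplies the wave of frequency \<open>\<xi>\<close> by
  a symbol, as soon as it may be moved under this integral. At a fixed \<open>x\<close> the order is a constant
  \<open>a = \<alpha> x\<close>, and the estimates below have a constant that is the same for all \<open>a\<close> in \<open>(0, 2)\<close>.

  For the fractional Laplacian the symbol is \<open>|\<xi>|^a\<close>: truncating the kernel to \<open>|x - y| \<ge> \<epsilon>\<close> makes Fubini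
  available, and the truncated symbols increase to the integral of \<open>(1 - cos (\<xi> \<bullet> z)) / |z|^(d + a)\<close>
  (\<open>frac_lap_fourier\<close>). That integral is computed in \<open>nn_integral_riesz_kernel\<close> by writing the power of
  \<open>|z|\<close> as a mixture of Gaussians, which leaves two one-dimensional Gamma integrals; it equals \<open>|\<xi>|^a\<close>
  divided by the normalising constant.

  For the discrete operator the symbol is \<open>M_h(\<xi>)^(a/2)\<close>, for all \<open>\<xi>\<close> in \<open>\<real>^d\<close> and not only in the
  frequency box. The point is that the coefficients \<open>a_n\<close> are absolutely summable and that their Fourier
  series returns the symbol everywhere. With \<open>\<theta> = a/2\<close> and \<open>m\<close> the mean of the numbers \<open>cos \<eta>_p\<close>, the
  unscaled symbol is \<open>(2d)^\<theta> (1 - m)^\<theta>\<close>. The binomial series of \<open>1 - (1 - m)^\<theta>\<close> has nonnegative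
  coefficients with sum 1, and \<open>m^k\<close> is the characteristic function of the simple random walk after \<open>k\<close>
  steps. Hence the symbol is \<open>(2d)^\<theta> (1 - E exp (i \<eta> \<bullet> X))\<close> for a random lattice vector \<open>X\<close>
  (\<open>lattice_symbol_powr\<close>), the coefficient \<open>a_n\<close> is \<open>(2d)^\<theta>\<close> times \<open>[n = 0] - P(X = n)\<close>, and the operator is
  \<open>h^(-a) (2d)^\<theta> (u(x) - E u(x + h X))\<close> (\<open>frac_lap_h_eq\<close>). So absolute summability of the \<open>a_n\<close>
  comes from positivity instead of a decay estimate.

  Finally \<open>0 \<le> |\<xi>|^2 - M_h(\<xi>) \<le> h^2 |\<xi>|^4\<close>, because \<open>x^2 - sin^2 x \<le> x^4\<close>. Together with
  \<open>q \<le> q^(a/2)\<close> for \<open>0 \<le> q \<le> 1\<close> and \<open>min (1, r^2) \<le> r^s\<close> for \<open>r = h |\<xi>|\<close> this bounds the difference of the symbols by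
  \<open>h^s |\<xi>|^(a + s)\<close> (\<open>symbol_error\<close>), which is at most \<open>h^s\<close> times the weight of the Barron norm. The
  constant obtained is \<open>(2 \<pi>)^(-d)\<close>.
\<close>

section \<open>Gaussian integrals\<close>

text \<open>The one-dimensional case is the characteristic function of the standard normal distribution, rescaled.\<close>
lemma gaussian_fourier_real:
  fixes t \<xi> :: real
  assumes t: "t > 0"
  shows "integrable lborel (\<lambda>x. iexp (\<xi> * x) * complex_of_real (exp (- t * x\<^sup>2)))"
    and "(LINT x|lborel. iexp (\<xi> * x) * complex_of_real (exp (- t * x\<^sup>2))) =
      complex_of_real (sqrt (pi / t) * exp (- \<xi>\<^sup>2 / (4 * t)))"
proof -
  \<comment> \<open>The scaling that turns the standard normal density into a multiple of \<open>exp (- t * x^2)\<close>.\<close>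
  define c where "c = sqrt (2 * t)"
  have c: "c > 0" "c\<^sup>2 = 2 * t" using t by (auto simp: c_def)
  have ni: "integrable lborel (\<lambda>x. complex_of_real (std_normal_density x) * iexp (\<xi> / c * x))"
    by (rule Bochner_Integration.integrable_bound[OF integrable_normal_moment[of 1 0 0]])
       (auto simp: norm_mult)
  have chr: "(LINT x|lborel. complex_of_real (std_normal_density x) * iexp (\<xi> / c * x)) =
      complex_of_real (exp (- (\<xi> / c)\<^sup>2 / 2))"
    using fun_cong[OF char_std_normal_distribution, of "\<xi> / c"]
    unfolding char_def
    by (subst (asm) integral_density) (auto simp: normal_density_nonneg scaleR_conv_of_real)
  have eq: "complex_of_real (std_normal_density (0 + c * x)) * iexp (\<xi> / c * (0 + c * x)) =
      complex_of_real (1 / sqrt (2 * pi)) * (iexp (\<xi> * x) * complex_of_real (exp (- t * x\<^sup>2)))" for x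
    using c by (simp add: std_normal_density_def power_mult_distrib)
  have i1: "integrable lborel (\<lambda>x. complex_of_real (1 / sqrt (2 * pi)) *
      (iexp (\<xi> * x) * complex_of_real (exp (- t * x\<^sup>2))))"
    using lborel_integrable_real_affine[OF ni, of c 0] c unfolding eq by simp
  show I: "integrable lborel (\<lambda>x. iexp (\<xi> * x) * complex_of_real (exp (- t * x\<^sup>2)))"
    using integrable_mult_right[OF i1, of "complex_of_real (sqrt (2 * pi))"]
    by (simp add: mult.assoc[symmetric] flip: of_real_mult)
  have "complex_of_real (exp (- (\<xi> / c)\<^sup>2 / 2)) = c *\<^sub>R (LINT x|lborel. complex_of_real (1 / sqrt (2 * pi)) *
      (iexp (\<xi> * x) * complex_of_real (exp (- t * x\<^sup>2))))"
    using lborel_integral_real_affine[of c "\<lambda>x. complex_of_real (std_normal_density x) * iexp (\<xi> / c * x)" 0] c(1)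
    unfolding eq chr by simp
  also have "\<dots> = complex_of_real (c / sqrt (2 * pi)) * (LINT x|lborel. iexp (\<xi> * x) * complex_of_real (exp (- t * x\<^sup>2)))"
    using I by (simp add: scaleR_conv_of_real)
  also have "c / sqrt (2 * pi) = 1 / sqrt (pi / t)"
    using t by (simp add: c_def real_sqrt_divide real_sqrt_mult)
  finally show "(LINT x|lborel. iexp (\<xi> * x) * complex_of_real (exp (- t * x\<^sup>2))) =
      complex_of_real (sqrt (pi / t) * exp (- \<xi>\<^sup>2 / (4 * t)))"
    using t c by (simp add: field_simps power_divide)
qed

text \<open>Fubini on a Euclidean space: Lebesgue measure is the image of the product of the one-dimensional
  Lebesgue measures. It serves the Gaussians, and later the characters of the torus.\<close>
lemma integral_lborel_prod:
  fixes g :: "'a::euclidean_space \<Rightarrow> real \<Rightarrow> complex"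
  assumes g: "\<And>b. integrable lborel (g b)"
  shows "integrable lborel (\<lambda>x. \<Prod>b\<in>Basis. g b (x \<bullet> b))"
    and "(LINT x|lborel. (\<Prod>b\<in>Basis. g b (x \<bullet> b))) = (\<Prod>b\<in>Basis. LINT x|lborel. g b x)"
proof -
  interpret product_sigma_finite "\<lambda>_::'a. lborel :: real measure"
    by unfold_locales
  let ?T = "\<lambda>f. \<Sum>b\<in>Basis. f b *\<^sub>R (b::'a)"
  let ?F = "\<lambda>x. \<Prod>b\<in>Basis. g b (x \<bullet> b)"
  have T: "?T \<in> measurable (\<Pi>\<^sub>M b\<in>Basis. lborel) borel"
    by measurable
  have [measurable]: "g b \<in> borel_measurable borel" for b
    using g[of b] by auto
  have F: "?F \<in> borel_measurable borel" by measurable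
  have prod: "?F (?T f) = (\<Prod>b\<in>Basis. g b (f b))" for f
    by (intro prod.cong) auto
  have eq: "(LINT x|lborel. ?F x) = integral\<^sup>L (Pi\<^sub>M Basis (\<lambda>_. lborel)) (\<lambda>f. \<Prod>b\<in>Basis. g b (f b))"
    by (subst lborel_eq, subst integral_distr) (auto simp only: prod T F)
  show "integrable lborel ?F"
    by (subst lborel_eq, subst integrable_distr_eq[OF T F], subst prod,
        rule product_integrable_prod[OF finite_Basis g])
  show "(LINT x|lborel. ?F x) = (\<Prod>b\<in>Basis. LINT x|lborel. g b x)"
    unfolding eq by (rule product_integral_prod[OF finite_Basis g])
qed

lemma gaussian_fourier:
  fixes \<xi> :: "'a::euclidean_space"
  assumes t: "t > 0"
  shows "integrable lborel (\<lambda>x. iexp (\<xi> \<bullet> x) * complex_of_real (exp (- t * (norm x)\<^sup>2)))"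
    and "(LINT x|lborel. iexp (\<xi> \<bullet> x) * complex_of_real (exp (- t * (norm x)\<^sup>2))) =
      complex_of_real (sqrt (pi / t) ^ DIM('a) * exp (- (norm \<xi>)\<^sup>2 / (4 * t)))"
proof -
  let ?g = "\<lambda>b (x::real). iexp ((\<xi> \<bullet> b) * x) * complex_of_real (exp (- t * x\<^sup>2))"
  let ?F = "\<lambda>x. iexp (\<xi> \<bullet> x) * complex_of_real (exp (- t * (norm x)\<^sup>2))"
  have sq: "(norm x)\<^sup>2 = (\<Sum>b\<in>Basis. (x \<bullet> b)\<^sup>2)" for x :: 'a
    unfolding power2_norm_eq_inner by (subst euclidean_inner) (simp add: power2_eq_square)
  have prod: "?F = (\<lambda>x. \<Prod>b\<in>Basis. ?g b (x \<bullet> b))"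
  proof
    fix x :: 'a
    have "\<xi> \<bullet> x = (\<Sum>b\<in>Basis. (\<xi> \<bullet> b) * (x \<bullet> b))"
      by (rule euclidean_inner)
    then show "?F x = (\<Prod>b\<in>Basis. ?g b (x \<bullet> b))"
      unfolding sq by (simp only: prod.distrib flip: of_real_prod)
        (simp add: exp_sum sum_distrib_left flip: sum_negf)
  qed
  show "integrable lborel ?F"
    unfolding prod by (rule integral_lborel_prod(1)[OF gaussian_fourier_real(1)[OF t]])
  have "(LINT x|lborel. ?F x) = (\<Prod>b\<in>Basis. complex_of_real (sqrt (pi / t) * exp (- (\<xi> \<bullet> b)\<^sup>2 / (4 * t))))"
    unfolding prod
    by (subst integral_lborel_prod(2)[OF gaussian_fourier_real(1)[OF t]])
       (simp only: gaussian_fourier_real(2)[OF t])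
  also have "\<dots> = complex_of_real (sqrt (pi / t) ^ DIM('a) * exp (- (norm \<xi>)\<^sup>2 / (4 * t)))"
    unfolding sq of_real_prod[symmetric] prod.distrib prod_constant exp_sum[OF finite_Basis, symmetric]
    by (simp add: sum_negf flip: sum_divide_distrib)
  finally show "(LINT x|lborel. ?F x) = complex_of_real (sqrt (pi / t) ^ DIM('a) * exp (- (norm \<xi>)\<^sup>2 / (4 * t)))" .
qed

lemma gaussian_integral:
  assumes t: "t > 0"
  shows "integrable lborel (\<lambda>x::'a::euclidean_space. exp (- t * (norm x)\<^sup>2))"
    and "(LINT x::'a|lborel. exp (- t * (norm x)\<^sup>2)) = sqrt (pi / t) ^ DIM('a)"
proof -
  show I: "integrable lborel (\<lambda>x::'a. exp (- t * (norm x)\<^sup>2))"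
    by (rule Bochner_Integration.integrable_bound[OF gaussian_fourier(1)[OF t, of 0]]) auto
  have "complex_of_real (LINT x::'a|lborel. exp (- t * (norm x)\<^sup>2)) = complex_of_real (sqrt (pi / t) ^ DIM('a))"
    using gaussian_fourier(2)[OF t, of "0::'a"] by (simp flip: of_real_exp)
  then show "(LINT x::'a|lborel. exp (- t * (norm x)\<^sup>2)) = sqrt (pi / t) ^ DIM('a)"
    unfolding of_real_eq_iff .
qed

text \<open>The form needed for the Riesz kernel: the integrand is nonnegative, so that Tonelli applies to
  mixtures over \<open>t\<close> without an integrability condition.\<close>
lemma gaussian_one_minus_cos:
  fixes \<xi> :: "'a::euclidean_space"
  assumes t: "t > 0"
  shows "(\<integral>\<^sup>+x. ennreal ((1 - cos (\<xi> \<bullet> x)) * exp (- t * (norm x)\<^sup>2)) \<partial>lborel) =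
    ennreal (sqrt (pi / t) ^ DIM('a) * (1 - exp (- (norm \<xi>)\<^sup>2 / (4 * t))))"
proof -
  have I: "integrable lborel (\<lambda>x. cos (\<xi> \<bullet> x) * exp (- t * (norm x)\<^sup>2))"
    by (rule Bochner_Integration.integrable_bound[OF gaussian_fourier(1)[OF t, of \<xi>]])
       (auto simp: norm_mult abs_mult)
  have "(LINT x|lborel. cos (\<xi> \<bullet> x) * exp (- t * (norm x)\<^sup>2)) =
      Re (LINT x|lborel. iexp (\<xi> \<bullet> x) * complex_of_real (exp (- t * (norm x)\<^sup>2)))"
    by (subst integral_Re[OF gaussian_fourier(1)[OF t], symmetric]) (auto simp: Re_exp intro!: Bochner_Integration.integral_cong)
  also have "\<dots> = sqrt (pi / t) ^ DIM('a) * exp (- (norm \<xi>)\<^sup>2 / (4 * t))"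
    by (simp only: gaussian_fourier(2)[OF t] Re_complex_of_real)
  finally have c: "(LINT x|lborel. cos (\<xi> \<bullet> x) * exp (- t * (norm x)\<^sup>2)) = sqrt (pi / t) ^ DIM('a) * exp (- (norm \<xi>)\<^sup>2 / (4 * t))" .
  have "(LINT x|lborel. (1 - cos (\<xi> \<bullet> x)) * exp (- t * (norm x)\<^sup>2)) =
      sqrt (pi / t) ^ DIM('a) * (1 - exp (- (norm \<xi>)\<^sup>2 / (4 * t)))"
    unfolding left_diff_distrib mult_1
    by (subst Bochner_Integration.integral_diff[OF gaussian_integral(1)[OF t] I])
       (simp only: c gaussian_integral(2)[OF t] right_diff_distrib mult_1_right)
  moreover have "integrable lborel (\<lambda>x. (1 - cos (\<xi> \<bullet> x)) * exp (- t * (norm x)\<^sup>2))"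
    unfolding left_diff_distrib mult_1
    by (rule Bochner_Integration.integrable_diff[OF gaussian_integral(1)[OF t] I])
  ultimately show ?thesis
    by (subst nn_integral_eq_integral) auto
qed

section \<open>Fourier inversion\<close>

text \<open>If \<open>f\<close> is not integrable, both sides are 0 by convention.\<close>
lemma integral_lborel_affine:
  fixes f :: "'a::euclidean_space \<Rightarrow> 'b::{banach, second_countable_topology}"
  assumes f [measurable]: "f \<in> borel_measurable borel" and c: "c \<noteq> 0"
  shows "(LINT x|lborel. f x) = \<bar>c\<bar> ^ DIM('a) *\<^sub>R (LINT x|lborel. f (t + c *\<^sub>R x))"
proof -
  have "(LINT x|lborel. f x) = (LINT x|density (distr lborel borel (\<lambda>x. t + c *\<^sub>R x)) (\<lambda>_. ennreal (\<bar>c\<bar> ^ DIM('a))). f x)"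
    using c by (subst lborel_affine[of c t]) (auto simp: ennreal_power)
  also have "\<dots> = (LINT x|lborel. \<bar>c\<bar> ^ DIM('a) *\<^sub>R f (t + c *\<^sub>R x))"
    by (subst integral_density) (auto simp: integral_distr)
  also have "\<dots> = \<bar>c\<bar> ^ DIM('a) *\<^sub>R (LINT x|lborel. f (t + c *\<^sub>R x))"
    using c by (cases "integrable lborel (\<lambda>x. f (t + c *\<^sub>R x))") (auto simp: not_integrable_integral_eq)
  finally show ?thesis .
qed

text \<open>The function \<open>u\<close> may be unbounded away from \<open>x\<close>, so dominated convergence after rescaling is only
  available near \<open>x\<close>. Away from \<open>x\<close> the kernel itself tends to 0 uniformly, and integrability of \<open>u\<close> suffices.\<close>
lemma gaussian_approximate_identity:
  fixes u :: "'a::euclidean_space \<Rightarrow> real" and x :: 'a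
  assumes u: "integrable lborel u" and cont: "isCont u x"
  defines "m \<equiv> \<lambda>n. real (Suc n)"
  shows "(\<lambda>n. LINT y|lborel. u y * (m n ^ DIM('a) * exp (- ((m n)\<^sup>2 * (norm (x - y))\<^sup>2))))
    \<longlonglongrightarrow> u x * sqrt pi ^ DIM('a)"
proof -
  have m: "m n > 0" for n by (simp add: m_def)
  have um [measurable]: "u \<in> borel_measurable borel"
    using u by auto
  obtain \<delta> where \<delta>: "\<delta> > 0" "\<And>y. dist y x < \<delta> \<Longrightarrow> dist (u y) (u x) < 1"
    using cont unfolding continuous_at_eps_delta by (meson zero_less_one)
  let ?K = "\<lambda>n y. m n ^ DIM('a) * exp (- ((m n)\<^sup>2 * (norm (x - y))\<^sup>2))"
  let ?B = "ball x \<delta>"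
  define un where "un y = indicator ?B y * u y" for y
  define uf where "uf y = indicator (- ?B) y * u y" for y
  have split: "u y = un y + uf y" for y
    by (simp add: un_def uf_def indicator_def)
  have [measurable]: "un \<in> borel_measurable borel"
    unfolding un_def by (rule borel_measurable_times[OF borel_measurable_indicator um]) simp
  have [measurable]: "uf \<in> borel_measurable borel"
    unfolding uf_def by (rule borel_measurable_times[OF borel_measurable_indicator um]) simp
  have K: "?K n y \<ge> 0" "?K n y \<le> m n ^ DIM('a)" for n y
    using m[of n] by (auto intro!: mult_left_le)
  have int: "integrable lborel (\<lambda>y. v y * ?K n y)"
    if [measurable]: "v \<in> borel_measurable borel" and "\<And>y. \<bar>v y\<bar> \<le> \<bar>u y\<bar>" for v n
  proof (rule Bochner_Integration.integrable_bound[OF integrable_mult_left[OF u, of "m n ^ DIM('a)"]])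
    show "AE y in lborel. norm (v y * ?K n y) \<le> norm (u y * m n ^ DIM('a))"
    proof (intro AE_I2)
      fix y
      have "\<bar>v y\<bar> * ?K n y \<le> \<bar>u y\<bar> * m n ^ DIM('a)"
        using that K by (intro mult_mono) auto
      then show "norm (v y * ?K n y) \<le> norm (u y * m n ^ DIM('a))"
        using m[of n] by (simp add: abs_mult)
    qed
  qed measurable
  have near: "(\<lambda>n. LINT y|lborel. un y * ?K n y) \<longlonglongrightarrow> u x * sqrt pi ^ DIM('a)"
  proof -
    have "(LINT y|lborel. un y * ?K n y) = (LINT z|lborel. un (x + (1 / m n) *\<^sub>R z) * exp (- 1 * (norm z)\<^sup>2))" for n
      using m[of n] by (subst integral_lborel_affine[of _ "1 / m n" x])
        (auto simp: power_mult_distrib power_divide simp flip: Bochner_Integration.integral_mult_right_zero)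
    moreover have "(\<lambda>n. LINT z|lborel. un (x + (1 / m n) *\<^sub>R z) * exp (- 1 * (norm z)\<^sup>2)) \<longlonglongrightarrow>
        (LINT z::'a|lborel. u x * exp (- 1 * (norm z)\<^sup>2))"
    proof (rule integral_dominated_convergence)
      show "integrable lborel (\<lambda>z::'a. (\<bar>u x\<bar> + 1) * exp (- 1 * (norm z)\<^sup>2))"
        by (intro integrable_mult_right gaussian_integral) simp
      show "AE z in lborel. (\<lambda>n. un (x + (1 / m n) *\<^sub>R z) * exp (- 1 * (norm z)\<^sup>2)) \<longlonglongrightarrow> u x * exp (- 1 * (norm z)\<^sup>2)"
      proof (intro AE_I2 tendsto_mult_right)
        fix z
        have "(\<lambda>n. x + (1 / m n) *\<^sub>R z) \<longlonglongrightarrow> x + 0 *\<^sub>R z"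
          unfolding m_def by (intro tendsto_intros lim_inverse_n'[THEN LIMSEQ_Suc])
        then have lim: "(\<lambda>n. x + (1 / m n) *\<^sub>R z) \<longlonglongrightarrow> x" by simp
        have "\<forall>\<^sub>F n in sequentially. dist (x + (1 / m n) *\<^sub>R z) x < \<delta>"
          using lim \<delta>(1) by (rule tendstoD)
        then have "\<forall>\<^sub>F n in sequentially. u (x + (1 / m n) *\<^sub>R z) = un (x + (1 / m n) *\<^sub>R z)"
          by eventually_elim (simp add: un_def dist_commute)
        moreover have "(\<lambda>n. u (x + (1 / m n) *\<^sub>R z)) \<longlonglongrightarrow> u x"
          using cont lim by (rule isCont_tendsto_compose)
        ultimately show "(\<lambda>n. un (x + (1 / m n) *\<^sub>R z)) \<longlonglongrightarrow> u x"
          by (rule Lim_transform_eventually[rotated])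
      qed
      show "AE z in lborel. norm (un (x + (1 / m n) *\<^sub>R z) * exp (- 1 * (norm z)\<^sup>2)) \<le> (\<bar>u x\<bar> + 1) * exp (- 1 * (norm z)\<^sup>2)" for n
      proof (intro AE_I2)
        fix z
        have "\<bar>un y\<bar> \<le> \<bar>u x\<bar> + 1" for y
          using \<delta>(2)[of y] by (auto simp: un_def indicator_def dist_commute dist_real_def)
        then show "norm (un (x + (1 / m n) *\<^sub>R z) * exp (- 1 * (norm z)\<^sup>2)) \<le> (\<bar>u x\<bar> + 1) * exp (- 1 * (norm z)\<^sup>2)"
          by (simp add: abs_mult)
      qed
    qed measurable
    moreover have "(LINT z::'a|lborel. u x * exp (- 1 * (norm z)\<^sup>2)) = u x * sqrt pi ^ DIM('a)"
      by (subst integral_mult_right_zero, subst gaussian_integral(2)) simp_all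
    ultimately show ?thesis by (simp only:)
  qed
  have far: "(\<lambda>n. LINT y|lborel. uf y * ?K n y) \<longlonglongrightarrow> 0"
  proof (rule Lim_null_comparison)
    let ?q = "\<lambda>n. m n ^ DIM('a) * exp (- ((m n)\<^sup>2 * \<delta>\<^sup>2))"
    show "\<forall>\<^sub>F n in sequentially. norm (LINT y|lborel. uf y * ?K n y) \<le> (LINT y|lborel. \<bar>u y\<bar>) * ?q n"
    proof (intro always_eventually allI)
      fix n
      have "norm (LINT y|lborel. uf y * ?K n y) \<le> (LINT y|lborel. \<bar>u y\<bar> * ?q n)"
      proof (rule Bochner_Integration.integral_norm_bound_integral)
        show "integrable lborel (\<lambda>y. uf y * ?K n y)"
          by (intro int) (auto simp: uf_def indicator_def)
        show "integrable lborel (\<lambda>y. \<bar>u y\<bar> * ?q n)"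
          using u by (intro integrable_mult_left integrable_abs)
        show "norm (uf y * ?K n y) \<le> \<bar>u y\<bar> * ?q n" for y
          using m[of n] \<delta>(1)
          by (auto simp: uf_def indicator_def abs_mult dist_norm intro!: mult_left_mono power_mono)
      qed
      then show "norm (LINT y|lborel. uf y * ?K n y) \<le> (LINT y|lborel. \<bar>u y\<bar>) * ?q n"
        by simp
    qed
    have "?q \<longlonglongrightarrow> 0"
      unfolding m_def using \<delta>(1) by real_asymp
    then show "(\<lambda>n. (LINT y|lborel. \<bar>u y\<bar>) * ?q n) \<longlonglongrightarrow> 0"
      by (rule tendsto_mult_right_zero)
  qed
  have "(LINT y|lborel. u y * ?K n y) = (LINT y|lborel. un y * ?K n y) + (LINT y|lborel. uf y * ?K n y)" for n
    unfolding split[of _] distrib_right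
    by (intro Bochner_Integration.integral_add int) (auto simp: un_def uf_def indicator_def)
  then show ?thesis
    using tendsto_add[OF near far] by simp
qed

lemma borel_measurable_fourier [measurable]:
  assumes [measurable]: "u \<in> borel_measurable borel"
  shows "fourier u \<in> borel_measurable borel"
proof -
  have "(\<lambda>\<xi>. LINT x|lborel. exp (- (\<i> * complex_of_real (\<xi> \<bullet> x))) * complex_of_real (u x)) \<in> borel_measurable borel"
    by (rule lborel.borel_measurable_lebesgue_integral) measurable
  then show ?thesis unfolding fourier_def .
qed

text \<open>Inserting the factor \<open>exp (- t |\<xi>|^2)\<close> into the inversion integral makes the double integral over
  \<open>\<xi>\<close> and \<open>y\<close> absolutely convergent. By Fubini it is a Gaussian average of \<open>u\<close> around \<open>x\<close>, which tends to
  a multiple of \<open>u x\<close> as \<open>t\<close> tends to 0; the integral itself converges to the one without the factor, because the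
  transform is integrable.\<close>
lemma fourier_inversion:
  fixes u :: "real^'d \<Rightarrow> real"
  assumes u: "integrable lborel u" and cont: "continuous_on UNIV u"
    and F: "integrable lborel (fourier u)"
  shows "complex_of_real (u x) =
    complex_of_real (1 / (2 * pi) ^ CARD('d)) * (LINT \<xi>|lborel. iexp (\<xi> \<bullet> x) * fourier u \<xi>)"
proof -
  have [measurable]: "u \<in> borel_measurable borel"
    using u by auto
  define m where "m n = real (Suc n)" for n
  \<comment> \<open>Chosen so that the transform of \<open>exp (- t n * |\<xi>|^2)\<close> is the Gaussian of width \<open>1 / m n\<close>.\<close>
  define t where "t n = 1 / (4 * (m n)\<^sup>2)" for n
  have m: "m n > 0" and t: "t n > 0" for n by (auto simp: m_def t_def)
  define G where "G n \<xi> = exp (- t n * (norm \<xi>)\<^sup>2)" for n and \<xi> :: "real^'d"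
  have [measurable]: "G n \<in> borel_measurable borel" for n
    unfolding G_def by measurable
  let ?I = "\<lambda>n. LINT \<xi>|lborel. iexp (\<xi> \<bullet> x) * fourier u \<xi> * complex_of_real (G n \<xi>)"
  have 1: "?I \<longlonglongrightarrow> (LINT \<xi>|lborel. iexp (\<xi> \<bullet> x) * fourier u \<xi>)"
  proof (rule integral_dominated_convergence)
    show "integrable lborel (\<lambda>\<xi>. norm (fourier u \<xi>))"
      using F by (rule integrable_norm)
    show "AE \<xi> in lborel. (\<lambda>n. iexp (\<xi> \<bullet> x) * fourier u \<xi> * complex_of_real (G n \<xi>)) \<longlonglongrightarrow> iexp (\<xi> \<bullet> x) * fourier u \<xi>"
    proof (intro AE_I2)
      fix \<xi> :: "real^'d"
      have "(\<lambda>n. G n \<xi>) \<longlonglongrightarrow> 1"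
        unfolding G_def t_def m_def by real_asymp
      then have "(\<lambda>n. iexp (\<xi> \<bullet> x) * fourier u \<xi> * complex_of_real (G n \<xi>)) \<longlonglongrightarrow> iexp (\<xi> \<bullet> x) * fourier u \<xi> * complex_of_real 1"
        by (intro tendsto_intros)
      then show "(\<lambda>n. iexp (\<xi> \<bullet> x) * fourier u \<xi> * complex_of_real (G n \<xi>)) \<longlonglongrightarrow> iexp (\<xi> \<bullet> x) * fourier u \<xi>"
        by simp
    qed
    show "AE \<xi> in lborel. norm (iexp (\<xi> \<bullet> x) * fourier u \<xi> * complex_of_real (G n \<xi>)) \<le> norm (fourier u \<xi>)" for n
      using t[of n] by (intro AE_I2) (auto simp: norm_mult G_def intro!: mult_left_le)
  qed measurable
  have 2: "?I n = complex_of_real ((2 * sqrt pi) ^ CARD('d) * (LINT y|lborel. u y * (m n ^ CARD('d) * exp (- ((m n)\<^sup>2 * (norm (x - y))\<^sup>2)))))" for n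
  proof -
    let ?f = "\<lambda>\<xi> y. iexp (\<xi> \<bullet> x) * (exp (- (\<i> * complex_of_real (\<xi> \<bullet> y))) * complex_of_real (u y)) * complex_of_real (G n \<xi>)"
    have G: "integrable lborel (G n)"
      unfolding G_def by (rule gaussian_integral(1)[OF t])
    have J: "integrable (lborel \<Otimes>\<^sub>M lborel) (\<lambda>(\<xi>, y). ?f \<xi> y)"
    proof (rule lborel_pair.Fubini_integrable)
      show "(\<lambda>(\<xi>, y). ?f \<xi> y) \<in> borel_measurable (lborel \<Otimes>\<^sub>M lborel)"
        by measurable
      have "(LINT y|lborel. norm (?f \<xi> y)) = (LINT y|lborel. \<bar>u y\<bar>) * G n \<xi>" for \<xi>
        by (simp add: norm_mult G_def)
      then show "integrable lborel (\<lambda>\<xi>. LINT y|lborel. norm (case (\<xi>, y) of (\<xi>, y) \<Rightarrow> ?f \<xi> y))"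
        using G by simp
      show "AE \<xi> in lborel. integrable lborel (\<lambda>y. case (\<xi>, y) of (\<xi>, y) \<Rightarrow> ?f \<xi> y)"
      proof (intro AE_I2)
        fix \<xi> :: "real^'d"
        show "integrable lborel (\<lambda>y. case (\<xi>, y) of (\<xi>, y) \<Rightarrow> ?f \<xi> y)"
          by (rule Bochner_Integration.integrable_bound[OF integrable_mult_left[OF u, of "G n \<xi>"]])
             (auto simp: norm_mult)
      qed
    qed
    have "?I n = (LINT \<xi>|lborel. LINT y|lborel. ?f \<xi> y)"
      by (simp add: fourier_def)
    also have "\<dots> = (LINT y|lborel. LINT \<xi>|lborel. ?f \<xi> y)"
      using lborel_pair.Fubini_integral[OF J] by simp
    also have "\<dots> = (LINT y|lborel. complex_of_real (u y) * (LINT \<xi>|lborel. iexp ((x - y) \<bullet> \<xi>) * complex_of_real (G n \<xi>)))"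
      by (simp add: inner_diff_left inner_commute algebra_simps exp_diff exp_minus field_simps flip: integral_mult_right_zero)
    also have "\<dots> = (LINT y|lborel. complex_of_real ((2 * sqrt pi) ^ CARD('d) * (u y * (m n ^ CARD('d) * exp (- ((m n)\<^sup>2 * (norm (x - y))\<^sup>2))))))"
    proof -
      have "sqrt (pi / t n) = 2 * sqrt pi * m n" "4 * t n = 1 / (m n)\<^sup>2"
        using m[of n] by (auto simp: t_def real_sqrt_mult)
      then have "(LINT \<xi>|lborel. iexp ((x - y) \<bullet> \<xi>) * complex_of_real (G n \<xi>)) =
          complex_of_real ((2 * sqrt pi) ^ CARD('d) * (m n ^ CARD('d) * exp (- ((m n)\<^sup>2 * (norm (x - y))\<^sup>2))))" for y
        unfolding G_def gaussian_fourier(2)[OF t]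
        by (simp add: power_mult_distrib mult_ac)
      then show ?thesis
        by (simp add: mult_ac)
    qed
    finally show ?thesis by (simp only: integral_complex_of_real integral_mult_right_zero)
  qed
  have "(\<lambda>n. complex_of_real ((2 * sqrt pi) ^ CARD('d) * (LINT y|lborel. u y * (m n ^ CARD('d) * exp (- ((m n)\<^sup>2 * (norm (x - y))\<^sup>2))))))
     \<longlonglongrightarrow> complex_of_real ((2 * sqrt pi) ^ CARD('d) * (u x * sqrt pi ^ CARD('d)))"
    using gaussian_approximate_identity[OF u, of x] cont unfolding m_def
    by (intro tendsto_intros) (auto simp: continuous_on_eq_continuous_at)
  then have "?I \<longlonglongrightarrow> complex_of_real ((2 * sqrt pi) ^ CARD('d) * (u x * sqrt pi ^ CARD('d)))"
    unfolding 2 .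
  from LIMSEQ_unique[OF 1 this]
  have "(LINT \<xi>|lborel. iexp (\<xi> \<bullet> x) * fourier u \<xi>) = complex_of_real ((2 * sqrt pi) ^ CARD('d) * (u x * sqrt pi ^ CARD('d)))" .
  also have "(2 * sqrt pi) ^ CARD('d) * (u x * sqrt pi ^ CARD('d)) = (2 * pi) ^ CARD('d) * u x"
  proof -
    have "(2 * sqrt pi) ^ CARD('d) * sqrt pi ^ CARD('d) = (2 * sqrt pi * sqrt pi) ^ CARD('d)"
      by (rule power_mult_distrib[symmetric])
    also have "2 * sqrt pi * sqrt pi = 2 * pi" by simp
    finally show ?thesis by (metis mult.assoc mult.commute)
  qed
  finally show ?thesis by simp
qed

section \<open>The Riesz kernel and its Fourier constant\<close>

lemma nn_integral_gamma:
  fixes s b :: real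
  assumes s: "s > 0" and b: "b > 0"
  shows "(\<integral>\<^sup>+t. ennreal (indicator {0<..} t * (t powr (s - 1) * exp (- b * t))) \<partial>lborel) =
    ennreal (Gamma s / b powr s)"
proof -
  have "ennreal (Gamma s) = (\<integral>\<^sup>+t. ennreal (indicator {0..} t * t powr (s - 1) / exp t) \<partial>lborel)"
    by (rule Gamma_conv_nn_integral_real[OF s])
  also have "\<dots> = \<bar>b\<bar> * (\<integral>\<^sup>+t. ennreal (indicator {0..} (0 + b * t) * (0 + b * t) powr (s - 1) / exp (0 + b * t)) \<partial>lborel)"
    using b by (intro nn_integral_real_affine) auto
  also have "\<dots> = ennreal b * (\<integral>\<^sup>+t. ennreal (b powr (s - 1)) * ennreal (indicator {0<..} t * (t powr (s - 1) * exp (- b * t))) \<partial>lborel)"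
    using b by (auto simp: ennreal_mult'[symmetric] indicator_def powr_mult exp_minus field_simps
        zero_le_mult_iff intro!: arg_cong2[where f="(*)"] nn_integral_cong)
  also have "\<dots> = ennreal (b powr s) * (\<integral>\<^sup>+t. ennreal (indicator {0<..} t * (t powr (s - 1) * exp (- b * t))) \<partial>lborel)"
    using b by (subst nn_integral_cmult) (auto simp: mult.assoc[symmetric] ennreal_mult'[symmetric] powr_diff)
  finally have "ennreal (Gamma s) * ennreal (1 / b powr s) = (ennreal (b powr s) * ennreal (1 / b powr s)) *
      (\<integral>\<^sup>+t. ennreal (indicator {0<..} t * (t powr (s - 1) * exp (- b * t))) \<partial>lborel)"
    by (simp add: mult_ac)
  then show ?thesis
    using b by (simp add: ennreal_mult''[symmetric])
qed

text \<open>This is Euler's integral after the substitution that sends \<open>t\<close> to \<open>b / t\<close>.\<close>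
lemma nn_integral_inverse_gamma:
  fixes s b :: real
  assumes s: "s > 0" and b: "b > 0"
  shows "(\<integral>\<^sup>+t. ennreal (indicator {0<..} t * (t powr (- s - 1) * exp (- b / t))) \<partial>lborel) =
    ennreal (Gamma s / b powr s)"
proof -
  let ?f = "\<lambda>t::real. t powr (s - 1) / exp t"
  let ?g = "\<lambda>t::real. b / t"
  have "((\<lambda>t. if t \<in> {0<..} then ?f t else 0) has_integral Gamma s) {0..}"
    by (rule has_integral_eq[OF _ Gamma_integral_real[OF s]]) auto
  then have f: "(?f has_integral Gamma s) {0<..}"
    by (subst (asm) has_integral_restrict) auto
  then have "?f absolutely_integrable_on {0<..}"
    by (intro nonnegative_absolutely_integrable_1) (auto simp: has_integral_integrable)
  moreover have "?g ` {0<..} = {0<..}"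
  proof
    show "{0<..} \<subseteq> ?g ` {0<..}"
    proof
      fix y :: real assume "y \<in> {0<..}"
      then show "y \<in> ?g ` {0<..}"
        using b by (intro image_eqI[of _ _ "b / y"]) auto
    qed
  qed (use b in auto)
  ultimately have "(\<lambda>x. \<bar>- b / x\<^sup>2\<bar> * ?f (?g x)) absolutely_integrable_on {0<..} \<and>
      integral {0<..} (\<lambda>x. \<bar>- b / x\<^sup>2\<bar> * ?f (?g x)) = Gamma s"
    using f b
    by (subst has_absolute_integral_change_of_variables_1'[where g = ?g])
       (auto simp: inj_on_def integral_unique power2_eq_square intro!: derivative_eq_intros)
  then have hi: "((\<lambda>x. \<bar>- b / x\<^sup>2\<bar> * ?f (?g x)) has_integral Gamma s) {0<..}"
    by (metis has_integral_integral set_lebesgue_integral_eq_integral(1))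
  have eq: "\<bar>- b / x\<^sup>2\<bar> * ?f (?g x) = b powr s * (x powr (- s - 1) * exp (- b / x))" if "x \<in> {0<..}" for x
  proof -
    have x: "x > 0" using that by simp
    then have e1: "x powr (- s - 1) = 1 / (x powr s * x)"
      by (simp add: powr_diff powr_minus_divide)
    have e2: "(b / x) powr (s - 1) = b powr s * x / (b * x powr s)"
      using b x by (simp add: powr_divide powr_diff)
    show ?thesis
      unfolding e1 e2 using b x by (simp add: exp_minus divide_simps power2_eq_square)
  qed
  have "((\<lambda>x. b powr s * (x powr (- s - 1) * exp (- b / x))) has_integral Gamma s) {0<..}"
    by (rule has_integral_eq[OF eq hi])
  then have "((\<lambda>x. 1 / b powr s * (b powr s * (x powr (- s - 1) * exp (- b / x)))) has_integral 1 / b powr s * Gamma s) {0<..}"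
    by (rule has_integral_mult_right)
  then have "((\<lambda>x. x powr (- s - 1) * exp (- b / x)) has_integral Gamma s / b powr s) {0<..}"
    using b by simp
  then show ?thesis
    by (intro nn_integral_has_integral_lebesgue) auto
qed

text \<open>The integrand is itself an integral, \<open>1 - exp (- B / t)\<close> being the integral of \<open>exp (- r / t) / t\<close>
  over \<open>r\<close> from 0 to \<open>B\<close>. By Tonelli the integral over \<open>t\<close> comes first; it gives a multiple of
  \<open>r^(\<theta> - 1)\<close>, which is integrable at 0.\<close>
lemma nn_integral_subordination:
  fixes \<theta> B :: real
  assumes \<theta>: "0 < \<theta>" "\<theta> < 1" and B: "B \<ge> 0"
  shows "(\<integral>\<^sup>+t. ennreal (indicator {0<..} t * (t powr (\<theta> - 1) * (1 - exp (- B / t)))) \<partial>lborel) =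
    ennreal (B powr \<theta> * Gamma (1 - \<theta>) / \<theta>)"
proof -
  let ?k = "\<lambda>t r. ennreal (indicator {0<..} t * (t powr (\<theta> - 2) * exp (- r / t)))"
  have "(\<integral>\<^sup>+t. ennreal (indicator {0<..} t * (t powr (\<theta> - 1) * (1 - exp (- B / t)))) \<partial>lborel) =
      (\<integral>\<^sup>+t. (\<integral>\<^sup>+r. ?k t r * indicator {0..B} r \<partial>lborel) \<partial>lborel)"
  proof (rule nn_integral_cong)
    fix t :: real
    show "ennreal (indicator {0<..} t * (t powr (\<theta> - 1) * (1 - exp (- B / t)))) =
        (\<integral>\<^sup>+r. ?k t r * indicator {0..B} r \<partial>lborel)"
    proof (cases "t > 0")
      case True
      have "(\<integral>\<^sup>+r. ennreal (exp (- r / t) / t) * indicator {0..B} r \<partial>lborel) = ennreal (- exp (- B / t) - (- exp (- 0 / t)))"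
        using True B by (intro nn_integral_FTC_Icc) (auto intro!: derivative_eq_intros simp: field_simps)
      then have "ennreal (t powr (\<theta> - 1)) * (\<integral>\<^sup>+r. ennreal (exp (- r / t) / t) * indicator {0..B} r \<partial>lborel) =
          ennreal (t powr (\<theta> - 1) * (1 - exp (- B / t)))"
        by (simp add: ennreal_mult')
      moreover have "ennreal (t powr (\<theta> - 1)) * (\<integral>\<^sup>+r. ennreal (exp (- r / t) / t) * indicator {0..B} r \<partial>lborel) =
          (\<integral>\<^sup>+r. ?k t r * indicator {0..B} r \<partial>lborel)"
      proof (subst nn_integral_cmult[symmetric])
        have "t powr (\<theta> - 1) = t * t powr (\<theta> - 2)"
          using True powr_add[of t 1 "\<theta> - 2"] by simp
        then show "(\<integral>\<^sup>+r. ennreal (t powr (\<theta> - 1)) * (ennreal (exp (- r / t) / t) * indicator {0..B} r) \<partial>lborel) =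
            (\<integral>\<^sup>+r. ?k t r * indicator {0..B} r \<partial>lborel)"
          using True by (auto simp: indicator_def ennreal_mult'[symmetric] intro!: nn_integral_cong)
      qed auto
      ultimately show ?thesis using True by simp
    qed simp
  qed
  also have "\<dots> = (\<integral>\<^sup>+r. (\<integral>\<^sup>+t. ?k t r * indicator {0..B} r \<partial>lborel) \<partial>lborel)"
    by (rule lborel_pair.Fubini') measurable
  also have "\<dots> = (\<integral>\<^sup>+r. ennreal (Gamma (1 - \<theta>)) * ennreal (indicator {0..B} r * r powr (\<theta> - 1)) \<partial>lborel)"
  proof (rule nn_integral_cong_AE)
    show "AE r in lborel. (\<integral>\<^sup>+t. ?k t r * indicator {0..B} r \<partial>lborel) =
        ennreal (Gamma (1 - \<theta>)) * ennreal (indicator {0..B} r * r powr (\<theta> - 1))"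
    \<comment> \<open>At \<open>r = 0\<close> the Gamma integral diverges, but a single point is negligible.\<close>
    proof (rule AE_mp[OF AE_lborel_singleton[of 0]], intro AE_I2 impI)
      fix r :: real assume r: "r \<noteq> 0"
      show "(\<integral>\<^sup>+t. ?k t r * indicator {0..B} r \<partial>lborel) =
        ennreal (Gamma (1 - \<theta>)) * ennreal (indicator {0..B} r * r powr (\<theta> - 1))"
      proof (cases "r \<in> {0..B}")
        case True
        then have "(\<integral>\<^sup>+t. ?k t r \<partial>lborel) = ennreal (Gamma (1 - \<theta>) / r powr (1 - \<theta>))"
          using nn_integral_inverse_gamma[of "1 - \<theta>" r] \<theta> r by simp
        then show ?thesis
          using True \<theta> powr_minus_divide[of r "1 - \<theta>"] by (simp add: ennreal_mult'[symmetric] ennreal_mult''[symmetric])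
      qed simp
    qed
  qed
  also have "\<dots> = ennreal (Gamma (1 - \<theta>)) * (\<integral>\<^sup>+r. ennreal (indicator {0..B} r * r powr (\<theta> - 1)) \<partial>lborel)"
    by (rule nn_integral_cmult) measurable
  also have "(\<integral>\<^sup>+r. ennreal (indicator {0..B} r * r powr (\<theta> - 1)) \<partial>lborel) = ennreal (B powr \<theta> / \<theta>)"
    using has_integral_powr_from_0[of "\<theta> - 1" B] \<theta> B
    by (intro nn_integral_has_integral_lebesgue) auto
  finally show ?thesis
    using \<theta> by (simp add: ennreal_mult''[symmetric] mult.commute)
qed

lemma sqrt_power_eq_powr: "x > 0 \<Longrightarrow> sqrt x ^ n = x powr (real n / 2)"
  by (simp add: powr_half_sqrt[symmetric] powr_power)

text \<open>Euler's integral with the rate \<open>|z|^2\<close>. It reduces every integral of the Riesz kernel in \<open>d\<close>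
  dimensions to Gaussian ones.\<close>
lemma riesz_kernel_gaussian_mixture:
  fixes z :: "'a::euclidean_space"
  assumes p: "p > 0" and z: "z \<noteq> 0"
  shows "ennreal (1 / norm z powr (2 * p)) = ennreal (1 / Gamma p) *
    (\<integral>\<^sup>+t. ennreal (indicator {0<..} t * (t powr (p - 1) * exp (- t * (norm z)\<^sup>2))) \<partial>lborel)"
proof -
  have "((norm z)\<^sup>2) powr p = norm z powr (2 * p)"
    using z powr_powr[of "norm z" 2 p] by simp
  then show ?thesis
    using nn_integral_gamma[OF p, of "(norm z)\<^sup>2"] z Gamma_real_pos[OF p]
    by (simp add: ennreal_mult'[symmetric] mult.commute)
qed

text \<open>This is where the normalising constant comes from: after the Gaussian mixture and Tonelli, the inner
  integral is \<open>gaussian_one_minus_cos\<close> and the outer one is \<open>nn_integral_subordination\<close> with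
  \<open>\<theta> = a / 2\<close> and \<open>B = |\<xi>|^2 / 4\<close>.\<close>
lemma nn_integral_riesz_kernel:
  fixes \<xi> :: "'a::euclidean_space"
  assumes a: "0 < a" "a < 2"
  shows "(\<integral>\<^sup>+z. ennreal ((1 - cos (\<xi> \<bullet> z)) / norm z powr (real DIM('a) + a)) \<partial>lborel) =
    ennreal (norm \<xi> powr a / frac_const DIM('a) a)"
proof -
  define d where "d = real DIM('a)"
  define p where "p = (a + d) / 2"
  have d: "d > 0" and p: "p > 0" using a by (auto simp: d_def p_def)
  have p2: "2 * p = real DIM('a) + a" by (simp add: p_def d_def)
  have \<Gamma>: "Gamma p > 0" using p by (rule Gamma_real_pos)
  let ?k = "\<lambda>z t. ennreal (indicator {0<..} t * (t powr (p - 1) * exp (- t * (norm z)\<^sup>2)))"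
  have "(\<integral>\<^sup>+z. ennreal ((1 - cos (\<xi> \<bullet> z)) / norm z powr (real DIM('a) + a)) \<partial>lborel) =
      (\<integral>\<^sup>+z. (\<integral>\<^sup>+t. ennreal (1 / Gamma p) * (ennreal (1 - cos (\<xi> \<bullet> z)) * ?k z t) \<partial>lborel) \<partial>lborel)"
  proof (rule nn_integral_cong)
    fix z :: 'a
    show "ennreal ((1 - cos (\<xi> \<bullet> z)) / norm z powr (real DIM('a) + a)) =
        (\<integral>\<^sup>+t. ennreal (1 / Gamma p) * (ennreal (1 - cos (\<xi> \<bullet> z)) * ?k z t) \<partial>lborel)"
    proof (cases "z = 0")
      case False
      have "ennreal ((1 - cos (\<xi> \<bullet> z)) / norm z powr (real DIM('a) + a)) =
          ennreal (1 - cos (\<xi> \<bullet> z)) * ennreal (1 / norm z powr (2 * p))"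
        by (simp add: ennreal_mult'[symmetric] p2)
      also have "\<dots> = ennreal (1 / Gamma p) * (ennreal (1 - cos (\<xi> \<bullet> z)) * (\<integral>\<^sup>+t. ?k z t \<partial>lborel))"
        unfolding riesz_kernel_gaussian_mixture[OF p False] by (simp add: mult_ac)
      also have "\<dots> = (\<integral>\<^sup>+t. ennreal (1 / Gamma p) * (ennreal (1 - cos (\<xi> \<bullet> z)) * ?k z t) \<partial>lborel)"
        by (simp add: nn_integral_cmult)
      finally show ?thesis .
    qed simp
  qed
  also have "\<dots> = (\<integral>\<^sup>+t. (\<integral>\<^sup>+z. ennreal (1 / Gamma p) * (ennreal (1 - cos (\<xi> \<bullet> z)) * ?k z t) \<partial>lborel) \<partial>lborel)"
    by (rule lborel_pair.Fubini') measurable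
  also have "\<dots> = (\<integral>\<^sup>+t. ennreal (pi powr (d / 2) / Gamma p) *
      ennreal (indicator {0<..} t * (t powr (a / 2 - 1) * (1 - exp (- ((norm \<xi>)\<^sup>2 / 4) / t)))) \<partial>lborel)"
  proof (rule nn_integral_cong)
    fix t :: real
    show "(\<integral>\<^sup>+z. ennreal (1 / Gamma p) * (ennreal (1 - cos (\<xi> \<bullet> z)) * ?k z t) \<partial>lborel) =
      ennreal (pi powr (d / 2) / Gamma p) *
        ennreal (indicator {0<..} t * (t powr (a / 2 - 1) * (1 - exp (- ((norm \<xi>)\<^sup>2 / 4) / t))))"
    proof (cases "t > 0")
      case True
      have "(\<integral>\<^sup>+z. ennreal (1 / Gamma p) * (ennreal (1 - cos (\<xi> \<bullet> z)) * ?k z t) \<partial>lborel) =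
          (\<integral>\<^sup>+z. ennreal (t powr (p - 1) / Gamma p) * ennreal ((1 - cos (\<xi> \<bullet> z)) * exp (- t * (norm z)\<^sup>2)) \<partial>lborel)"
        using True \<Gamma> by (intro nn_integral_cong) (simp add: ennreal_mult'[symmetric] mult_ac)
      also have "\<dots> = ennreal (t powr (p - 1) / Gamma p) *
          ennreal (sqrt (pi / t) ^ DIM('a) * (1 - exp (- (norm \<xi>)\<^sup>2 / (4 * t))))"
        unfolding gaussian_one_minus_cos[OF True, symmetric] by (rule nn_integral_cmult) measurable
      also have "\<dots> = ennreal (t powr (p - 1) / Gamma p * (sqrt (pi / t) ^ DIM('a) * (1 - exp (- (norm \<xi>)\<^sup>2 / (4 * t)))))"
        using \<Gamma> by (simp add: ennreal_mult'[symmetric])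
      also have "sqrt (pi / t) ^ DIM('a) = pi powr (d / 2) * t powr (- d / 2)"
        using True by (simp add: sqrt_power_eq_powr powr_divide d_def powr_minus_divide)
      also have "t powr (p - 1) / Gamma p * (pi powr (d / 2) * t powr (- d / 2) * (1 - exp (- (norm \<xi>)\<^sup>2 / (4 * t)))) =
         pi powr (d / 2) / Gamma p * ((t powr (p - 1) * t powr (- d / 2)) * (1 - exp (- (norm \<xi>)\<^sup>2 / (4 * t))))"
        by simp
      also have "t powr (p - 1) * t powr (- d / 2) = t powr (a / 2 - 1)"
        unfolding powr_add[symmetric] by (rule arg_cong[where f="(powr) t"]) (simp add: p_def field_simps)
      finally show ?thesis
        using True \<Gamma> by (simp add: ennreal_mult'[symmetric])
    qed simp
  qed
  also have "\<dots> = ennreal (pi powr (d / 2) / Gamma p) * ennreal (((norm \<xi>)\<^sup>2 / 4) powr (a / 2) * Gamma (1 - a / 2) / (a / 2))"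
    using a by (subst nn_integral_cmult, measurable) (subst nn_integral_subordination, auto)
  also have "\<dots> = ennreal (pi powr (d / 2) / Gamma p * (((norm \<xi>)\<^sup>2 / 4) powr (a / 2) * Gamma (1 - a / 2) / (a / 2)))"
    using \<Gamma> by (simp add: ennreal_mult'[symmetric])
  also have "((norm \<xi>)\<^sup>2 / 4) powr (a / 2) = norm \<xi> powr a / 2 powr a"
  proof -
    have "(norm \<xi>)\<^sup>2 / 4 = (norm \<xi> / 2) powr 2"
      by (cases "\<xi> = 0") (auto simp: power_divide)
    then show ?thesis
      by (simp only: powr_powr) (simp add: powr_divide)
  qed
  also have "pi powr (d / 2) / Gamma p * (norm \<xi> powr a / 2 powr a * Gamma (1 - a / 2) / (a / 2)) =
      norm \<xi> powr a / frac_const DIM('a) a"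
    using a by (simp add: frac_const_def p_def d_def powr_diff field_simps)
  finally show ?thesis .
qed

text \<open>For \<open>|z| \<ge> \<epsilon>\<close>, half of the Gaussian exponent can be spent on the bound
  \<open>exp (- t |z|^2) \<le> exp (- t \<epsilon>^2 / 2) exp (- t |z|^2 / 2)\<close>. Integrating in \<open>z\<close> and then in \<open>t\<close> leaves
  a Gamma integral that converges at both ends, so polar coordinates are avoided.\<close>
lemma riesz_kernel_integrable_off_ball:
  assumes a: "a > 0" and \<epsilon>: "\<epsilon> > 0"
  shows "integrable lborel (\<lambda>z::'a::euclidean_space. indicator (- ball 0 \<epsilon>) z / norm z powr (real DIM('a) + a))"
proof (rule integrableI_bounded)
  define d where "d = real DIM('a)"
  define p where "p = (a + d) / 2"
  have d: "d > 0" and p: "p > 0" using a by (auto simp: d_def p_def)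
  have p2: "2 * p = real DIM('a) + a" by (simp add: p_def d_def)
  have \<Gamma>: "Gamma p > 0" using p by (rule Gamma_real_pos)
  let ?g = "\<lambda>(z::'a) t. ennreal (1 / Gamma p) * ennreal (indicator {0<..} t * (t powr (p - 1) * exp (- (\<epsilon>\<^sup>2 / 2) * t)) * exp (- (t / 2) * (norm z)\<^sup>2))"
  have "(\<integral>\<^sup>+(z::'a). ennreal (norm (indicator (- ball 0 \<epsilon>) z / norm z powr (real DIM('a) + a))) \<partial>lborel) \<le>
      (\<integral>\<^sup>+z. (\<integral>\<^sup>+t. ?g z t \<partial>lborel) \<partial>lborel)"
  proof (rule nn_integral_mono)
    fix z :: 'a
    show "ennreal (norm (indicator (- ball 0 \<epsilon>) z / norm z powr (real DIM('a) + a))) \<le> (\<integral>\<^sup>+t. ?g z t \<partial>lborel)"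
    proof (cases "z \<in> ball 0 \<epsilon>")
      case False
      then have z: "norm z \<ge> \<epsilon>" "z \<noteq> 0" using \<epsilon> by auto
      have "ennreal (norm (indicator (- ball 0 \<epsilon>) z / norm z powr (real DIM('a) + a))) = ennreal (1 / norm z powr (2 * p))"
        using False by (simp add: p2)
      also have "\<dots> = (\<integral>\<^sup>+t. ennreal (1 / Gamma p) * ennreal (indicator {0<..} t * (t powr (p - 1) * exp (- t * (norm z)\<^sup>2))) \<partial>lborel)"
        unfolding riesz_kernel_gaussian_mixture[OF p z(2)] by (rule nn_integral_cmult[symmetric]) measurable
      also have "\<dots> \<le> (\<integral>\<^sup>+t. ?g z t \<partial>lborel)"
      proof (intro nn_integral_mono mult_left_mono ennreal_leI)
        fix t :: real
        have "\<epsilon>\<^sup>2 * t \<le> (norm z)\<^sup>2 * t" if "t > 0"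
          using that z \<epsilon> by (intro mult_right_mono power_mono) auto
        then have "exp (- t * (norm z)\<^sup>2) \<le> exp (- (\<epsilon>\<^sup>2 / 2) * t) * exp (- (t / 2) * (norm z)\<^sup>2)" if "t > 0"
          using that unfolding exp_add[symmetric] by (simp add: field_simps)
        then show "indicator {0<..} t * (t powr (p - 1) * exp (- t * (norm z)\<^sup>2)) \<le>
            indicator {0<..} t * (t powr (p - 1) * exp (- (\<epsilon>\<^sup>2 / 2) * t)) * exp (- (t / 2) * (norm z)\<^sup>2)"
          by (auto simp: indicator_def mult.assoc intro!: mult_left_mono)
      qed simp
      finally show ?thesis .
    qed simp
  qed
  also have "\<dots> = (\<integral>\<^sup>+t. (\<integral>\<^sup>+z. ?g z t \<partial>lborel) \<partial>lborel)"
    by (rule lborel_pair.Fubini') measurable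
  also have "\<dots> = (\<integral>\<^sup>+t. ennreal ((2 * pi) powr (d / 2) / Gamma p) *
      ennreal (indicator {0<..} t * (t powr (a / 2 - 1) * exp (- (\<epsilon>\<^sup>2 / 2) * t))) \<partial>lborel)"
  proof (rule nn_integral_cong)
    fix t :: real
    show "(\<integral>\<^sup>+z. ?g z t \<partial>lborel) = ennreal ((2 * pi) powr (d / 2) / Gamma p) *
      ennreal (indicator {0<..} t * (t powr (a / 2 - 1) * exp (- (\<epsilon>\<^sup>2 / 2) * t)))"
    proof (cases "t > 0")
      case True
      let ?c = "t powr (p - 1) * exp (- (\<epsilon>\<^sup>2 / 2) * t) / Gamma p"
      have "(\<integral>\<^sup>+z. ?g z t \<partial>lborel) = (\<integral>\<^sup>+(z::'a). ennreal ?c * ennreal (exp (- (t / 2) * (norm z)\<^sup>2)) \<partial>lborel)"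
        using True \<Gamma> by (intro nn_integral_cong) (simp add: ennreal_mult'[symmetric])
      also have "\<dots> = ennreal ?c * (\<integral>\<^sup>+(z::'a). ennreal (exp (- (t / 2) * (norm z)\<^sup>2)) \<partial>lborel)"
        by (rule nn_integral_cmult) measurable
      also have "(\<integral>\<^sup>+(z::'a). ennreal (exp (- (t / 2) * (norm z)\<^sup>2)) \<partial>lborel) = ennreal (sqrt (pi / (t / 2)) ^ DIM('a))"
        using True gaussian_integral[of "t / 2", where ?'a = 'a]
        by (subst nn_integral_eq_integral) auto
      also have "ennreal ?c * \<dots> = ennreal (?c * sqrt (pi / (t / 2)) ^ DIM('a))"
        using \<Gamma> by (simp add: ennreal_mult'[symmetric])
      also have "sqrt (pi / (t / 2)) ^ DIM('a) = (2 * pi) powr (d / 2) * t powr (- d / 2)"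
        using True sqrt_power_eq_powr[of "pi / (t / 2)" "DIM('a)"]
        by (simp add: powr_divide d_def powr_minus_divide mult.commute)
      also have "?c * ((2 * pi) powr (d / 2) * t powr (- d / 2)) =
          (2 * pi) powr (d / 2) / Gamma p * ((t powr (p - 1) * t powr (- d / 2)) * exp (- (\<epsilon>\<^sup>2 / 2) * t))"
        by simp
      also have "t powr (p - 1) * t powr (- d / 2) = t powr (a / 2 - 1)"
        unfolding powr_add[symmetric] by (rule arg_cong[where f="(powr) t"]) (simp add: p_def field_simps)
      finally show ?thesis
        using True \<Gamma> by (simp add: ennreal_mult'[symmetric])
    qed simp
  qed
  also have "\<dots> = ennreal ((2 * pi) powr (d / 2) / Gamma p) * ennreal (Gamma (a / 2) / (\<epsilon>\<^sup>2 / 2) powr (a / 2))"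
    using a \<epsilon> by (subst nn_integral_cmult, measurable) (subst nn_integral_gamma, auto)
  also have "\<dots> < \<infinity>"
    by (simp add: ennreal_mult_less_top)
  finally show "(\<integral>\<^sup>+(z::'a). ennreal (norm (indicator (- ball 0 \<epsilon>) z / norm z powr (real DIM('a) + a))) \<partial>lborel) < \<infinity>" .
qed (rule borel_measurable_divide[OF borel_measurable_indicator], simp, measurable)

section \<open>The fractional Laplacian as a Fourier multiplier\<close>

lemma frac_const_pos: "0 < a \<Longrightarrow> a < 2 \<Longrightarrow> 0 < frac_const n a"
  unfolding frac_const_def by (intro divide_pos_pos mult_pos_pos Gamma_real_pos) auto

lemma riesz_kernel_integral:
  fixes \<xi> :: "'a::euclidean_space"
  assumes a: "0 < a" "a < 2"
  shows "integrable lborel (\<lambda>z. (1 - cos (\<xi> \<bullet> z)) / norm z powr (real DIM('a) + a))"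
    and "(LINT z|lborel. (1 - cos (\<xi> \<bullet> z)) / norm z powr (real DIM('a) + a)) =
      norm \<xi> powr a / frac_const DIM('a) a"
proof -
  show I: "integrable lborel (\<lambda>z. (1 - cos (\<xi> \<bullet> z)) / norm z powr (real DIM('a) + a))"
    by (rule integrableI_nonneg) (auto simp: nn_integral_riesz_kernel[OF a])
  have "norm \<xi> powr a / frac_const DIM('a) a \<ge> 0"
    using frac_const_pos[OF a, of "DIM('a)"] by simp
  then show "(LINT z|lborel. (1 - cos (\<xi> \<bullet> z)) / norm z powr (real DIM('a) + a)) =
      norm \<xi> powr a / frac_const DIM('a) a"
    by (subst integral_eq_nn_integral) (auto simp: nn_integral_riesz_kernel[OF a])
qed

definition riesz_kernel_off :: "real \<Rightarrow> real \<Rightarrow> 'a::euclidean_space \<Rightarrow> real" where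
  "riesz_kernel_off a \<epsilon> z = indicator (- ball 0 \<epsilon>) z / norm z powr (real DIM('a) + a)"

text \<open>The symbol of the operator whose kernel is cut off at distance \<open>\<epsilon>\<close>, up to the constant \<open>frac_const\<close>.\<close>
definition truncated_symbol :: "real \<Rightarrow> real \<Rightarrow> 'a::euclidean_space \<Rightarrow> real" where
  "truncated_symbol a \<epsilon> \<xi> = (LINT z|lborel. riesz_kernel_off a \<epsilon> z * (1 - cos (\<xi> \<bullet> z)))"

lemma riesz_kernel_off_nonneg: "riesz_kernel_off a \<epsilon> z \<ge> 0"
  by (simp add: riesz_kernel_off_def)

lemma riesz_kernel_off_uminus: "riesz_kernel_off a \<epsilon> (- z) = riesz_kernel_off a \<epsilon> z"
  by (simp add: riesz_kernel_off_def indicator_def)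

lemma integrable_riesz_kernel_off:
  "a > 0 \<Longrightarrow> \<epsilon> > 0 \<Longrightarrow> integrable lborel (riesz_kernel_off a \<epsilon>)"
  using riesz_kernel_integrable_off_ball unfolding riesz_kernel_off_def .

lemma borel_measurable_riesz_kernel_off [measurable]:
  "riesz_kernel_off a \<epsilon> \<in> borel_measurable borel"
  unfolding riesz_kernel_off_def
  by (rule borel_measurable_divide[OF borel_measurable_indicator], simp, measurable)

lemma borel_measurable_truncated_symbol [measurable]:
  "truncated_symbol a \<epsilon> \<in> borel_measurable borel"
proof -
  have "(\<lambda>\<xi>. LINT z|lborel. riesz_kernel_off a \<epsilon> z * (1 - cos (\<xi> \<bullet> z))) \<in> borel_measurable borel"
    by (rule lborel.borel_measurable_lebesgue_integral) measurable
  then show ?thesis unfolding truncated_symbol_def .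
qed

text \<open>The integrand is nonnegative, so discarding the ball costs nothing; the bound is uniform in \<open>\<epsilon>\<close> and
  dominates the limit \<open>\<epsilon> \<rightarrow> 0\<close> under the frequency integral.\<close>
lemma truncated_symbol_le:
  fixes \<xi> :: "'a::euclidean_space"
  assumes a: "0 < a" "a < 2"
  shows "\<bar>truncated_symbol a \<epsilon> \<xi>\<bar> \<le> norm \<xi> powr a / frac_const DIM('a) a"
proof -
  have "norm (truncated_symbol a \<epsilon> \<xi>) \<le> (LINT z|lborel. (1 - cos (\<xi> \<bullet> z)) / norm z powr (real DIM('a) + a))"
    unfolding truncated_symbol_def
  proof (rule Bochner_Integration.integral_norm_bound_integral)
    show le: "norm (riesz_kernel_off a \<epsilon> z * (1 - cos (\<xi> \<bullet> z))) \<le> (1 - cos (\<xi> \<bullet> z)) / norm z powr (real DIM('a) + a)" for z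
      by (simp add: riesz_kernel_off_def abs_mult indicator_def)
    show I: "integrable lborel (\<lambda>z. (1 - cos (\<xi> \<bullet> z)) / norm z powr (real DIM('a) + a))"
      by (rule riesz_kernel_integral[OF a])
    show "integrable lborel (\<lambda>z. riesz_kernel_off a \<epsilon> z * (1 - cos (\<xi> \<bullet> z)))"
    proof (rule Bochner_Integration.integrable_bound[OF I])
      show "AE z in lborel. norm (riesz_kernel_off a \<epsilon> z * (1 - cos (\<xi> \<bullet> z))) \<le> norm ((1 - cos (\<xi> \<bullet> z)) / norm z powr (real DIM('a) + a))"
        using order_trans[OF le abs_ge_self] by (intro AE_I2) (simp only: real_norm_def)
    qed measurable
  qed
  then show ?thesis
    by (simp add: riesz_kernel_integral(2)[OF a])
qed

lemma truncated_symbol_tendsto: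
  fixes \<xi> :: "'a::euclidean_space"
  assumes a: "0 < a" "a < 2" and S: "S \<longlonglongrightarrow> 0"
  shows "(\<lambda>n. truncated_symbol a (S n) \<xi>) \<longlonglongrightarrow> norm \<xi> powr a / frac_const DIM('a) a"
  unfolding truncated_symbol_def riesz_kernel_integral(2)[OF a, symmetric]
proof (rule integral_dominated_convergence)
  show "integrable lborel (\<lambda>z. (1 - cos (\<xi> \<bullet> z)) / norm z powr (real DIM('a) + a))"
    by (rule riesz_kernel_integral[OF a])
  show "AE z in lborel. norm (riesz_kernel_off a (S n) z * (1 - cos (\<xi> \<bullet> z))) \<le> (1 - cos (\<xi> \<bullet> z)) / norm z powr (real DIM('a) + a)" for n
    by (intro AE_I2) (simp add: riesz_kernel_off_def abs_mult indicator_def)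
  show "AE z in lborel. (\<lambda>n. riesz_kernel_off a (S n) z * (1 - cos (\<xi> \<bullet> z))) \<longlonglongrightarrow> (1 - cos (\<xi> \<bullet> z)) / norm z powr (real DIM('a) + a)"
  proof (intro AE_I2)
    fix z :: 'a
    \<comment> \<open>For \<open>z = 0\<close> both sides are 0, because \<open>cos 0 = 1\<close>.\<close>
    show "(\<lambda>n. riesz_kernel_off a (S n) z * (1 - cos (\<xi> \<bullet> z))) \<longlonglongrightarrow> (1 - cos (\<xi> \<bullet> z)) / norm z powr (real DIM('a) + a)"
    proof (cases "z = 0")
      case False
      then have "\<forall>\<^sub>F n in sequentially. S n < norm z"
        using S by (intro order_tendstoD) auto
      then have "\<forall>\<^sub>F n in sequentially. (1 - cos (\<xi> \<bullet> z)) / norm z powr (real DIM('a) + a) =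
          riesz_kernel_off a (S n) z * (1 - cos (\<xi> \<bullet> z))"
        by eventually_elim (simp add: riesz_kernel_off_def)
      then show ?thesis
        by (rule Lim_transform_eventually[OF tendsto_const])
    qed simp
  qed
qed measurable

text \<open>The kernel is even, so the sine part of \<open>1 - exp (i \<xi> \<bullet> z)\<close> integrates to 0.\<close>
lemma truncated_symbol_complex:
  fixes \<xi> :: "'a::euclidean_space"
  assumes a: "a > 0" and \<epsilon>: "\<epsilon> > 0"
  shows "(LINT z|lborel. complex_of_real (riesz_kernel_off a \<epsilon> z) * (1 - iexp (\<xi> \<bullet> z))) =
    complex_of_real (truncated_symbol a \<epsilon> \<xi>)"
proof -
  let ?k = "\<lambda>z. complex_of_real (riesz_kernel_off a \<epsilon> z)"
  let ?J = "LINT z|lborel. ?k z * (1 - iexp (\<xi> \<bullet> z))"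
  have I: "integrable lborel (\<lambda>z. ?k z * (1 - iexp (\<xi> \<bullet> z)))"
  proof (rule Bochner_Integration.integrable_bound[OF integrable_mult_left[OF integrable_riesz_kernel_off[OF a \<epsilon>], of 2]])
    show "AE z in lborel. norm (?k z * (1 - iexp (\<xi> \<bullet> z))) \<le> norm (riesz_kernel_off a \<epsilon> z * 2)"
    proof (intro AE_I2)
      fix z
      have "norm (1 - iexp (\<xi> \<bullet> z)) \<le> 2"
        using norm_triangle_ineq4[of 1 "iexp (\<xi> \<bullet> z)"] by simp
      then show "norm (?k z * (1 - iexp (\<xi> \<bullet> z))) \<le> norm (riesz_kernel_off a \<epsilon> z * 2)"
        by (simp add: norm_mult abs_mult mult_left_mono)
    qed
  qed measurable
  \<comment> \<open>The reflection \<open>z \<mapsto> - z\<close> turns the integral into its conjugate.\<close>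
  have "?J = (LINT z|lborel. ?k (0 + (-1) *\<^sub>R z) * (1 - iexp (\<xi> \<bullet> (0 + (-1) *\<^sub>R z))))"
    by (subst integral_lborel_affine[of _ "-1" 0]) auto
  also have "\<dots> = (LINT z|lborel. cnj (?k z * (1 - iexp (\<xi> \<bullet> z))))"
    by (simp add: riesz_kernel_off_uminus exp_cnj)
  also have "\<dots> = cnj ?J"
    by (rule Bochner_Integration.integral_cnj)
  finally have "Im ?J = 0"
    by (metis Reals_cnj_iff complex_is_Real_iff)
  moreover have "Re ?J = truncated_symbol a \<epsilon> \<xi>"
    unfolding truncated_symbol_def
    by (subst integral_Re[OF I, symmetric]) (simp add: Re_exp)
  ultimately show ?thesis
    by (simp add: complex_eq_iff)
qed

text \<open>The principal value exists, and its limit may be taken under the frequency integral, because the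
  truncated symbols are bounded by a multiple of \<open>|\<xi>|^a\<close>.\<close>
lemma frac_lap_fourier:
  fixes u :: "real^'d \<Rightarrow> real"
  assumes u: "integrable lborel u" and cont: "continuous_on UNIV u"
    and F: "integrable lborel (fourier u)"
    and a: "0 < \<alpha> x" "\<alpha> x < 2"
    and Fa: "integrable lborel (\<lambda>\<xi>. norm \<xi> powr \<alpha> x * norm (fourier u \<xi>))"
  shows "complex_of_real (frac_lap \<alpha> u x) = complex_of_real (1 / (2 * pi) ^ CARD('d)) *
    (LINT \<xi>|lborel. iexp (\<xi> \<bullet> x) * fourier u \<xi> * complex_of_real (norm \<xi> powr \<alpha> x))"
proof -
  define a where "a = \<alpha> x"
  note a = a[folded a_def]
  define c where "c = frac_const CARD('d) a"
  define C where "C = complex_of_real (1 / (2 * pi) ^ CARD('d))"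
  have c: "c > 0" unfolding c_def using a by (rule frac_const_pos)
  have [measurable]: "u \<in> borel_measurable borel"
    using u by auto
  let ?k = "riesz_kernel_off a :: real \<Rightarrow> real^'d \<Rightarrow> real"
  define PV where "PV \<epsilon> = (LINT y:- ball x \<epsilon>|lborel. (u x - u y) / norm (x - y) powr (real CARD('d) + a))" for \<epsilon>
  define L where "L = C * (LINT \<xi>|lborel. iexp (\<xi> \<bullet> x) * fourier u \<xi> * complex_of_real (norm \<xi> powr a / c))"
  have PV: "complex_of_real (PV \<epsilon>) = C * (LINT \<xi>|lborel. iexp (\<xi> \<bullet> x) * fourier u \<xi> * complex_of_real (truncated_symbol a \<epsilon> \<xi>))"
    if \<epsilon>: "\<epsilon> > 0" for \<epsilon>
  proof -
    let ?f = "\<lambda>z \<xi>. complex_of_real (?k \<epsilon> z) * (iexp (\<xi> \<bullet> x) * fourier u \<xi> * (1 - iexp (\<xi> \<bullet> z)))"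
    have J0: "integrable (lborel \<Otimes>\<^sub>M lborel) (\<lambda>(z, \<xi>). ?k \<epsilon> z * (2 * norm (fourier u \<xi>)))"
    proof (rule lborel_pair.Fubini_integrable)
      show "AE z in lborel. integrable lborel (\<lambda>\<xi>. case (z, \<xi>) of (z, \<xi>) \<Rightarrow> ?k \<epsilon> z * (2 * norm (fourier u \<xi>)))"
        using F by (intro AE_I2) auto
      show "integrable lborel (\<lambda>z. LINT \<xi>|lborel. norm (case (z, \<xi>) of (z, \<xi>) \<Rightarrow> ?k \<epsilon> z * (2 * norm (fourier u \<xi>))))"
        using integrable_riesz_kernel_off[OF a(1) \<epsilon>, where ?'a = "real^'d"]
        by (simp add: abs_mult riesz_kernel_off_nonneg)
    qed measurable
    have J: "integrable (lborel \<Otimes>\<^sub>M lborel) (\<lambda>(z, \<xi>). ?f z \<xi>)"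
    proof (rule Bochner_Integration.integrable_bound[OF J0])
      have "norm (?f z \<xi>) \<le> norm (?k \<epsilon> z * (2 * norm (fourier u \<xi>)))" for z \<xi>
      proof -
        have "norm (1 - iexp (\<xi> \<bullet> z)) \<le> 2"
          using norm_triangle_ineq4[of 1 "iexp (\<xi> \<bullet> z)"] by simp
        then have "norm (fourier u \<xi>) * norm (1 - iexp (\<xi> \<bullet> z)) \<le> norm (fourier u \<xi>) * 2"
          by (rule mult_left_mono) simp
        then show ?thesis
          by (simp add: norm_mult abs_mult riesz_kernel_off_nonneg mult_left_mono mult.commute)
      qed
      then show "AE p in lborel \<Otimes>\<^sub>M lborel. norm (case p of (z, \<xi>) \<Rightarrow> ?f z \<xi>) \<le> norm (case p of (z, \<xi>) \<Rightarrow> ?k \<epsilon> z * (2 * norm (fourier u \<xi>)))"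
        by (intro AE_I2) auto
    qed measurable
    have bm: "(\<lambda>y. indicator (- ball x \<epsilon>) y *\<^sub>R ((u x - u y) / norm (x - y) powr (real CARD('d) + a))) \<in> borel_measurable borel"
      by (rule borel_measurable_scaleR[OF borel_measurable_indicator], simp, measurable)
    have "PV \<epsilon> = (LINT z|lborel. ?k \<epsilon> z * (u x - u (x + z)))"
      unfolding PV_def set_lebesgue_integral_def
      by (subst integral_lborel_affine[OF bm, of 1 x])
         (auto simp: riesz_kernel_off_def indicator_def dist_norm intro!: Bochner_Integration.integral_cong)
    then have "complex_of_real (PV \<epsilon>) = (LINT z|lborel. complex_of_real (?k \<epsilon> z) * complex_of_real (u x - u (x + z)))"
      by (simp flip: integral_complex_of_real)
    also have "\<dots> = (LINT z|lborel. C * (LINT \<xi>|lborel. ?f z \<xi>))"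
    proof (rule Bochner_Integration.integral_cong)
      fix z
      have I1: "integrable lborel (\<lambda>\<xi>. iexp (\<xi> \<bullet> y) * fourier u \<xi>)" for y
        by (rule Bochner_Integration.integrable_bound[OF F]) (auto simp: norm_mult)
      have "complex_of_real (u x - u (x + z)) =
          C * ((LINT \<xi>|lborel. iexp (\<xi> \<bullet> x) * fourier u \<xi>) - (LINT \<xi>|lborel. iexp (\<xi> \<bullet> (x + z)) * fourier u \<xi>))"
        using fourier_inversion[OF u cont F] by (simp add: C_def right_diff_distrib)
      also have "\<dots> = C * (LINT \<xi>|lborel. iexp (\<xi> \<bullet> x) * fourier u \<xi> - iexp (\<xi> \<bullet> (x + z)) * fourier u \<xi>)"
        by (subst Bochner_Integration.integral_diff[OF I1 I1]) simp
      also have "\<dots> = C * (LINT \<xi>|lborel. iexp (\<xi> \<bullet> x) * fourier u \<xi> * (1 - iexp (\<xi> \<bullet> z)))"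
        by (simp add: inner_add_right distrib_left exp_add algebra_simps)
      finally show "complex_of_real (?k \<epsilon> z) * complex_of_real (u x - u (x + z)) = C * (LINT \<xi>|lborel. ?f z \<xi>)"
        by (simp add: mult.left_commute)
    qed simp
    also have "\<dots> = C * (LINT z|lborel. LINT \<xi>|lborel. ?f z \<xi>)"
      by simp
    also have "(LINT z|lborel. LINT \<xi>|lborel. ?f z \<xi>) = (LINT \<xi>|lborel. LINT z|lborel. ?f z \<xi>)"
      using lborel_pair.Fubini_integral[OF J] by simp
    also have "\<dots> = (LINT \<xi>|lborel. iexp (\<xi> \<bullet> x) * fourier u \<xi> * (LINT z|lborel. complex_of_real (?k \<epsilon> z) * (1 - iexp (\<xi> \<bullet> z))))"
      by (simp only: integral_mult_right_zero[symmetric] mult.left_commute)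
    finally show ?thesis
      unfolding truncated_symbol_complex[OF a(1) \<epsilon>] .
  qed
  have seq: "(\<lambda>n. complex_of_real (PV (S n))) \<longlonglongrightarrow> L"
    if S: "\<And>n. S n > 0" "S \<longlonglongrightarrow> 0" for S
  proof -
    have "(\<lambda>n. LINT \<xi>|lborel. iexp (\<xi> \<bullet> x) * fourier u \<xi> * complex_of_real (truncated_symbol a (S n) \<xi>)) \<longlonglongrightarrow>
        (LINT \<xi>|lborel. iexp (\<xi> \<bullet> x) * fourier u \<xi> * complex_of_real (norm \<xi> powr a / c))"
    proof (rule integral_dominated_convergence)
      show "integrable lborel (\<lambda>\<xi>. 1 / c * (norm \<xi> powr a * norm (fourier u \<xi>)))"
        using Fa unfolding a_def by (rule integrable_mult_right)
      show "AE \<xi> in lborel. (\<lambda>n. iexp (\<xi> \<bullet> x) * fourier u \<xi> * complex_of_real (truncated_symbol a (S n) \<xi>)) \<longlonglongrightarrow>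
          iexp (\<xi> \<bullet> x) * fourier u \<xi> * complex_of_real (norm \<xi> powr a / c)"
        using truncated_symbol_tendsto[OF a S(2), where ?'a = "real^'d"] unfolding c_def
        by (intro AE_I2 tendsto_mult_left tendsto_of_real) simp
      show "AE \<xi> in lborel. norm (iexp (\<xi> \<bullet> x) * fourier u \<xi> * complex_of_real (truncated_symbol a (S n) \<xi>)) \<le>
          1 / c * (norm \<xi> powr a * norm (fourier u \<xi>))" for n
      proof (intro AE_I2)
        fix \<xi> :: "real^'d"
        have "norm (fourier u \<xi>) * \<bar>truncated_symbol a (S n) \<xi>\<bar> \<le> norm (fourier u \<xi>) * (norm \<xi> powr a / c)"
          using truncated_symbol_le[OF a, of "S n" \<xi>] unfolding c_def by (intro mult_left_mono) auto
        then show "norm (iexp (\<xi> \<bullet> x) * fourier u \<xi> * complex_of_real (truncated_symbol a (S n) \<xi>)) \<le>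
            1 / c * (norm \<xi> powr a * norm (fourier u \<xi>))"
          by (simp add: norm_mult mult_ac)
      qed
    qed measurable
    then show ?thesis
      unfolding PV[OF S(1)] L_def by (rule tendsto_mult_left)
  qed
  \<comment> \<open>Dominated convergence is sequential, so the one-sided limit is tested on sequences.\<close>
  have lim: "((\<lambda>\<epsilon>. complex_of_real (PV \<epsilon>)) \<longlongrightarrow> L) (at_right 0)"
    using zero_less_one by (rule tendsto_at_right_sequentially) (rule seq)
  have limR: "(PV \<longlongrightarrow> Re L) (at_right 0)"
    using tendsto_Re[OF lim] by simp
  have "L = complex_of_real (Re L)"
    by (rule tendsto_unique[OF trivial_limit_at_right_real lim tendsto_of_real[OF limR]])
  moreover have "pv_integral x (\<lambda>y. (u x - u y) / norm (x - y) powr (real CARD('d) + \<alpha> x)) = Re L"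
    unfolding pv_integral_def a_def[symmetric] using limR unfolding PV_def
    by (intro tendsto_Lim trivial_limit_at_right_real)
  ultimately have "complex_of_real (frac_lap \<alpha> u x) = complex_of_real c * L"
    unfolding frac_lap_def c_def a_def by (metis of_real_mult)
  also have "\<dots> = C * (LINT \<xi>|lborel. iexp (\<xi> \<bullet> x) * fourier u \<xi> * (complex_of_real c * complex_of_real (norm \<xi> powr a / c)))"
    unfolding L_def by (simp only: integral_mult_right_zero[symmetric] mult.left_commute)
  also have "\<dots> = C * (LINT \<xi>|lborel. iexp (\<xi> \<bullet> x) * fourier u \<xi> * complex_of_real (norm \<xi> powr a))"
  proof -
    have "complex_of_real c * complex_of_real (r / c) = complex_of_real r" for r
      using c by simp
    then show ?thesis by (simp only:)
  qed
  finally show ?thesis unfolding C_def a_def .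
qed

section \<open>Expectations of bounded functions\<close>

lemma integrable_pmf_bounded:
  fixes f :: "'b \<Rightarrow> 'c::{banach, second_countable_topology}"
  assumes b: "\<And>x. norm (f x) \<le> B"
  shows "integrable (measure_pmf P) f"
  by (rule measure_pmf.integrable_const_bound[where B=B]) (auto simp: b)

lemma norm_expectation_pmf_le:
  fixes f :: "'b \<Rightarrow> 'c::{banach, second_countable_topology}"
  assumes b: "\<And>x. norm (f x) \<le> B"
  shows "norm (LINT x|measure_pmf P. f x) \<le> B"
  by (rule order_trans[OF integral_norm_bound])
     (auto intro!: measure_pmf.integral_le_const integrable_norm integrable_pmf_bounded[where B=B] simp: b)

text \<open>Adding the bound \<open>B\<close> makes the function nonnegative, which reduces the claim to the corresponding
  one for nonnegative integrals.\<close>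
lemma integral_bind_pmf_real:
  fixes f :: "'b \<Rightarrow> real"
  assumes b: "\<And>x. \<bar>f x\<bar> \<le> B"
  shows "(LINT x|measure_pmf (bind_pmf M N). f x) = (LINT y|measure_pmf M. LINT x|measure_pmf (N y). f x)"
proof -
  have shift: "(\<integral>\<^sup>+x. ennreal (g x + B) \<partial>measure_pmf P) = ennreal ((LINT x|measure_pmf P. g x) + B)"
    and nonneg: "(LINT x|measure_pmf P. g x) + B \<ge> 0"
    if g: "\<And>x. \<bar>g x\<bar> \<le> B" for g :: "'e \<Rightarrow> real" and P
  proof -
    have I: "integrable (measure_pmf P) g"
      using g by (intro integrable_pmf_bounded[where B=B]) simp
    have "g x + B \<ge> 0" for x
      using g[of x] by simp
    then show "(\<integral>\<^sup>+x. ennreal (g x + B) \<partial>measure_pmf P) = ennreal ((LINT x|measure_pmf P. g x) + B)"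
      using I by (subst nn_integral_eq_integral) auto
    show "(LINT x|measure_pmf P. g x) + B \<ge> 0"
      using norm_expectation_pmf_le[of g B P] g by simp
  qed
  define h where "h y = (LINT x|measure_pmf (N y). f x)" for y
  have h: "\<bar>h y\<bar> \<le> B" for y
    using norm_expectation_pmf_le[of f B "N y"] b by (simp add: h_def)
  have "ennreal ((LINT x|measure_pmf (bind_pmf M N). f x) + B) = ennreal ((LINT y|measure_pmf M. h y) + B)"
    unfolding shift[OF b, symmetric] shift[OF h, symmetric] nn_integral_bind_pmf
    unfolding shift[OF b] h_def ..
  then show ?thesis
    using ennreal_inj[OF nonneg[of f, OF b] nonneg[of h, OF h]] unfolding h_def by simp
qed

lemma integral_bind_pmf_complex:
  fixes f :: "'b \<Rightarrow> complex"
  assumes b: "\<And>x. norm (f x) \<le> B"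
  shows "(LINT x|measure_pmf (bind_pmf M N). f x) = (LINT y|measure_pmf M. LINT x|measure_pmf (N y). f x)"
proof -
  have I: "integrable (measure_pmf P) f" for P
    by (rule integrable_pmf_bounded[OF b])
  have J: "integrable (measure_pmf M) (\<lambda>y. LINT x|measure_pmf (N y). f x)"
    by (rule integrable_pmf_bounded[where B=B]) (rule norm_expectation_pmf_le[OF b])
  have "\<bar>Re (f x)\<bar> \<le> B" "\<bar>Im (f x)\<bar> \<le> B" for x
    using b[of x] abs_Re_le_cmod[of "f x"] abs_Im_le_cmod[of "f x"] by auto
  then show ?thesis
    using integral_bind_pmf_real[of "\<lambda>x. Re (f x)" B M N] integral_bind_pmf_real[of "\<lambda>x. Im (f x)" B M N]
    by (simp add: complex_eq_iff integral_Re[OF I] integral_Im[OF I] integral_Re[OF J] integral_Im[OF J])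
qed

lemma has_sum_pmf:
  fixes f :: "'b \<Rightarrow> complex"
  assumes b: "\<And>x. norm (f x) \<le> B"
  shows "((\<lambda>x. complex_of_real (pmf P x) * f x) has_sum (LINT x|measure_pmf P. f x)) UNIV"
proof -
  have eq: "(\<lambda>x. complex_of_real (pmf P x) * f x) = (\<lambda>x. pmf P x *\<^sub>R f x)"
    by (simp add: scaleR_conv_of_real)
  have "integrable (density (count_space UNIV) (\<lambda>x. ennreal (pmf P x))) f"
    using integrable_pmf_bounded[OF b, of P] unfolding measure_pmf_eq_density[of P] .
  then have I: "integrable (count_space UNIV) (\<lambda>x. pmf P x *\<^sub>R f x)"
    by (subst (asm) integrable_density) auto
  have "(LINT x|measure_pmf P. f x) = (LINT x|count_space UNIV. pmf P x *\<^sub>R f x)"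
    unfolding measure_pmf_eq_density[of P] by (subst integral_density) auto
  also have "\<dots> = infsetsum (\<lambda>x. pmf P x *\<^sub>R f x) UNIV"
    by (simp add: infsetsum_def)
  also have "\<dots> = infsum (\<lambda>x. pmf P x *\<^sub>R f x) UNIV"
    using I by (intro infsetsum_infsum) (simp add: abs_summable_on_def)
  finally have "(LINT x|measure_pmf P. f x) = infsum (\<lambda>x. pmf P x *\<^sub>R f x) UNIV" .
  moreover have "(\<lambda>x. pmf P x *\<^sub>R f x) summable_on UNIV"
    by (rule abs_summable_summable, rule iffD2[OF abs_summable_equivalent]) (use I in \<open>simp add: abs_summable_on_def\<close>)
  ultimately show ?thesis
    unfolding eq by (metis has_sum_infsum)
qed

section \<open>The binomial series of a fractional power\<close>

text \<open>The coefficients of the power series of \<open>1 - (1 - z)^\<theta>\<close>.\<close>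
definition jump_weight :: "real \<Rightarrow> nat \<Rightarrow> real" where
  "jump_weight \<theta> k = (if k = 0 then 0 else - ((-1) ^ k * (\<theta> gchoose k)))"

text \<open>Consecutive coefficients have the quotient \<open>(k - \<theta>) / (k + 1)\<close>, which is positive from \<open>k = 1\<close> on
  since \<open>\<theta> < 1\<close>.\<close>
lemma jump_weight_nonneg:
  assumes \<theta>: "0 < \<theta>" "\<theta> < 1"
  shows "jump_weight \<theta> k \<ge> 0"
proof (cases k)
  case (Suc n)
  have "- ((-1) ^ Suc n * (\<theta> gchoose Suc n)) \<ge> 0"
  proof (induction n)
    case 0
    then show ?case using \<theta> by simp
  next
    case (Suc n)
    have e: "\<theta> gchoose Suc (Suc n) = (\<theta> - real (Suc n)) * (\<theta> gchoose Suc n) / real (Suc (Suc n))"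
      using gbinomial_mult_1[of \<theta> "Suc n"] by (simp add: field_simps)
    have "- ((-1) ^ Suc (Suc n) * (\<theta> gchoose Suc (Suc n))) =
        (real (Suc n) - \<theta>) / real (Suc (Suc n)) * - ((-1) ^ Suc n * (\<theta> gchoose Suc n))"
      unfolding e by (simp add: divide_simps) (simp add: algebra_simps)
    moreover have "(real (Suc n) - \<theta>) / real (Suc (Suc n)) \<ge> 0"
      using \<theta> by simp
    ultimately show ?case
      using mult_nonneg_nonneg[OF _ Suc.IH] by (simp only:)
  qed
  then show ?thesis
    using Suc by (simp add: jump_weight_def)
qed (simp add: jump_weight_def)

lemma jump_weight_sums_open:
  assumes z: "\<bar>z\<bar> < 1"
  shows "(\<lambda>k. jump_weight \<theta> k * z ^ k) sums (1 - (1 - z) powr \<theta>)"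
proof -
  have "(\<lambda>k. (\<theta> gchoose k) * (- z) ^ k) sums ((1 - z) powr \<theta>)"
    using gen_binomial_real[of "- z" \<theta>] z by simp
  then have "(\<lambda>k. (if k = 0 then 1 else 0) - (\<theta> gchoose k) * (- z) ^ k) sums (1 - (1 - z) powr \<theta>)"
    by (intro sums_diff sums_single[of 0 "\<lambda>_. 1", simplified] ) auto
  moreover have "(if k = 0 then 1 else 0) - (\<theta> gchoose k) * (- z) ^ k = jump_weight \<theta> k * z ^ k" for k
    by (auto simp: jump_weight_def power_minus[of z])
  ultimately show ?thesis by simp
qed

text \<open>By nonnegativity every partial sum at \<open>0 < z < 1\<close> is at most \<open>1 - (1 - z)^\<theta> \<le> 1\<close>; the bound
  persists for \<open>z \<rightarrow> 1\<close>.\<close>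
lemma summable_jump_weight:
  assumes \<theta>: "0 < \<theta>" "\<theta> < 1"
  shows "summable (jump_weight \<theta>)"
proof (rule summableI_nonneg_bounded[where x=1])
  fix n
  have "((\<lambda>z. \<Sum>k<n. jump_weight \<theta> k * z ^ k) \<longlongrightarrow> (\<Sum>k<n. jump_weight \<theta> k * 1 ^ k)) (at_left 1)"
    by (intro tendsto_intros)
  moreover have "\<forall>\<^sub>F z in at_left 1. (\<Sum>k<n. jump_weight \<theta> k * z ^ k) \<le> 1"
  proof -
    have "\<forall>\<^sub>F z::real in at_left 1. z \<in> {0<..<1}"
      by (rule eventually_at_leftI[of 0]) auto
    then show ?thesis
    proof eventually_elim
      case (elim z)
      have "(\<Sum>k<n. jump_weight \<theta> k * z ^ k) \<le> 1 - (1 - z) powr \<theta>"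
        using elim jump_weight_sums_open[of z \<theta>] jump_weight_nonneg[OF \<theta>]
        by (intro sum_le_suminf[THEN order_trans, OF sums_summable]) (auto simp: sums_iff)
      also have "\<dots> \<le> 1" by simp
      finally show ?case .
    qed
  qed
  ultimately show "(\<Sum>k<n. jump_weight \<theta> k) \<le> 1"
    by (intro tendsto_upperbound[where F="at_left (1::real)"]) auto
qed (rule jump_weight_nonneg[OF \<theta>])

text \<open>Summability of the coefficients gives uniform convergence on \<open>[-1, 1]\<close>, so the binomial series
  extends to the end points by continuity. At \<open>z = 1\<close> it says that the coefficients sum to 1; the point
  \<open>z = -1\<close> occurs as the mean cosine at the corners of the frequency box.\<close>
lemma jump_weight_sums:
  assumes \<theta>: "0 < \<theta>" "\<theta> < 1" and z: "\<bar>z\<bar> \<le> 1"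
  shows "(\<lambda>k. jump_weight \<theta> k * z ^ k) sums (1 - (1 - z) powr \<theta>)"
proof -
  let ?S = "{-1<..<1::real}"
  define h where "h z = (\<Sum>k. jump_weight \<theta> k * z ^ k) - (1 - (1 - z) powr \<theta>)" for z
  have bd: "norm (jump_weight \<theta> k * z ^ k) \<le> jump_weight \<theta> k" if "\<bar>z\<bar> \<le> 1" for k z
    using that jump_weight_nonneg[OF \<theta>, of k]
    by (auto simp: abs_mult power_abs intro!: mult_left_le power_le_one)
  have cl: "closure ?S = {-1..1}" by simp
  have "uniform_limit {-1..1} (\<lambda>n z. \<Sum>k<n. jump_weight \<theta> k * z ^ k) (\<lambda>z. \<Sum>k. jump_weight \<theta> k * z ^ k) sequentially"
    by (rule Weierstrass_m_test[OF bd summable_jump_weight[OF \<theta>]]) auto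
  then have "continuous_on {-1..1} (\<lambda>z. \<Sum>k. jump_weight \<theta> k * z ^ k)"
    by (rule uniform_limit_theorem[rotated]) (auto intro!: always_eventually continuous_intros)
  then have "continuous_on (closure ?S) h"
    unfolding cl h_def using \<theta> by (intro continuous_intros continuous_on_powr') auto
  moreover have "h x = 0" if "x \<in> ?S" for x
    using jump_weight_sums_open[of x \<theta>] that by (auto simp: h_def sums_iff)
  moreover have "z \<in> closure ?S" unfolding cl using z by auto
  ultimately have "h z = 0"
    by (rule continuous_constant_on_closure)
  moreover have "summable (\<lambda>k. jump_weight \<theta> k * z ^ k)"
    using bd[OF z] by (intro summable_comparison_test'[OF summable_jump_weight[OF \<theta>]]) auto
  ultimately show ?thesis
    by (simp add: h_def sums_iff)
qed

text \<open>The distribution on the natural numbers with the generating function \<open>1 - (1 - z)^\<theta>\<close>; it is known as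
  the Sibuya distribution.\<close>
definition jump_count :: "real \<Rightarrow> nat pmf" where
  "jump_count \<theta> = embed_pmf (jump_weight \<theta>)"

lemma pmf_jump_count:
  assumes \<theta>: "0 < \<theta>" "\<theta> < 1"
  shows "pmf (jump_count \<theta>) k = jump_weight \<theta> k"
  unfolding jump_count_def
proof (rule pmf_embed_pmf)
  have "jump_weight \<theta> sums 1"
    using jump_weight_sums[OF \<theta>, of 1] by simp
  then show "(\<integral>\<^sup>+k. ennreal (jump_weight \<theta> k) \<partial>count_space UNIV) = 1"
    using jump_weight_nonneg[OF \<theta>]
    by (simp add: nn_integral_count_space_nat suminf_ennreal2 sums_iff)
qed (rule jump_weight_nonneg[OF \<theta>])

lemma jump_count_generating_function:
  assumes \<theta>: "0 < \<theta>" "\<theta> < 1" and z: "\<bar>z\<bar> \<le> 1"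
  shows "(LINT k|measure_pmf (jump_count \<theta>). complex_of_real (z ^ k)) = complex_of_real (1 - (1 - z) powr \<theta>)"
proof -
  have "norm (complex_of_real (z ^ k)) \<le> 1" for k
    using z by (simp add: norm_power power_le_one)
  from has_sum_pmf[OF this, of "jump_count \<theta>"]
  have "(\<lambda>k. complex_of_real (pmf (jump_count \<theta>) k) * complex_of_real (z ^ k)) sums
      (LINT k|measure_pmf (jump_count \<theta>). complex_of_real (z ^ k))"
    by (rule has_sum_imp_sums)
  moreover have "(\<lambda>k. complex_of_real (pmf (jump_count \<theta>) k) * complex_of_real (z ^ k)) sums complex_of_real (1 - (1 - z) powr \<theta>)"
    using jump_weight_sums[OF \<theta> z]
    by (simp only: pmf_jump_count[OF \<theta>] of_real_mult[symmetric] sums_of_real_iff)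
  ultimately show ?thesis
    by (rule sums_unique2)
qed

section \<open>Interchanging sums and integrals\<close>

text \<open>Fubini for a countable sum and a Lebesgue integral, with a product bound \<open>b x * g y\<close> that makes absolute
  convergence immediate.\<close>
lemma integral_infsum_swap:
  fixes f :: "'a \<Rightarrow> 'b::euclidean_space \<Rightarrow> complex"
  assumes A: "countable A" and f [measurable]: "\<And>x. x \<in> A \<Longrightarrow> f x \<in> borel_measurable borel"
    and bd: "\<And>x y. x \<in> A \<Longrightarrow> norm (f x y) \<le> b x * g y"
    and b: "b summable_on A" "\<And>x. x \<in> A \<Longrightarrow> b x \<ge> 0"
    and g: "integrable lborel g"
  shows "(LINT y|lborel. (\<Sum>\<^sub>\<infinity>x\<in>A. f x y)) = (\<Sum>\<^sub>\<infinity>x\<in>A. (LINT y|lborel. f x y))"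
proof -
  have sig: "sigma_finite_measure (count_space A)"
    by (rule sigma_finite_measure_count_space_countable[OF A])
  interpret pair_sigma_finite "count_space A" "lborel :: 'b measure"
    by (intro pair_sigma_finite.intro sig sigma_finite_lborel)
  have abs: "Infinite_Set_Sum.abs_summable_on h A" if "\<And>x. x \<in> A \<Longrightarrow> norm (h x) \<le> b x * c" for h :: "'a \<Rightarrow> complex" and c
  proof (rule iffD1[OF abs_summable_equivalent])
    show "(\<lambda>x. norm (h x)) summable_on A"
      by (rule summable_on_comparison_test[where f="\<lambda>x. b x * c"]) (use b(1) that in \<open>auto intro!: summable_on_cmult_left\<close>)
  qed
  have intc: "integrable (count_space A) h" and infc: "(\<Sum>\<^sub>\<infinity>x\<in>A. h x) = (LINT x|count_space A. h x)"
    if "\<And>x. x \<in> A \<Longrightarrow> norm (h x) \<le> b x * c" for h :: "'a \<Rightarrow> complex" and c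
    using abs[OF that] infsetsum_infsum[OF abs[OF that]] by (auto simp: abs_summable_on_def infsetsum_def)
  have fi: "integrable lborel (f x)" if "x \<in> A" for x
    by (rule Bochner_Integration.integrable_bound[OF integrable_mult_right[OF g, of "b x"]])
       (use that bd[OF that] order_trans[OF _ abs_ge_self] in auto)
  have m: "(\<lambda>(x, y). f x y) \<in> borel_measurable (count_space A \<Otimes>\<^sub>M lborel)"
    by (rule measurable_pair_measure_countable1[OF A]) simp
  have nb: "norm (LINT y|lborel. norm (f x y)) \<le> b x * (LINT y|lborel. g y)" if "x \<in> A" for x
  proof -
    have "(LINT y|lborel. norm (f x y)) \<le> (LINT y|lborel. b x * g y)"
      by (intro Bochner_Integration.integral_mono integrable_norm fi that integrable_mult_right g bd)
    then show ?thesis by simp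
  qed
  have J: "integrable (count_space A \<Otimes>\<^sub>M lborel) (\<lambda>(x, y). f x y)"
  proof (rule Fubini_integrable[OF m])
    have "integrable (count_space A) (\<lambda>x. complex_of_real (LINT y|lborel. norm (f x y)))"
      using nb by (intro intc[where c="LINT y|lborel. g y"]) (simp only: norm_of_real real_norm_def)
    then show "integrable (count_space A) (\<lambda>x. LINT y|lborel. norm (case (x, y) of (x, y) \<Rightarrow> f x y))"
      by (simp only: complex_of_real_integrable_eq prod.case)
    show "AE x in count_space A. integrable lborel (\<lambda>y. case (x, y) of (x, y) \<Rightarrow> f x y)"
      using fi by (simp add: AE_count_space)
  qed
  have "(LINT y|lborel. (\<Sum>\<^sub>\<infinity>x\<in>A. f x y)) = (LINT y|lborel. LINT x|count_space A. f x y)"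
    using bd by (intro Bochner_Integration.integral_cong refl infc)
  also have "\<dots> = (LINT x|count_space A. LINT y|lborel. f x y)"
    using Fubini_integral[OF J] by simp
  also have "\<dots> = (\<Sum>\<^sub>\<infinity>x\<in>A. (LINT y|lborel. f x y))"
    by (rule infc[symmetric, where c="LINT y|lborel. g y"])
       (rule order_trans[OF integral_norm_bound order_trans[OF abs_ge_self nb[unfolded real_norm_def]]])
  finally show ?thesis .
qed

lemma integral_expectation_swap:
  fixes f :: "'a::countable \<Rightarrow> 'b::euclidean_space \<Rightarrow> complex"
  assumes f [measurable]: "\<And>x. f x \<in> borel_measurable borel"
    and bd: "\<And>x y. norm (f x y) \<le> g y" and g: "integrable lborel g"
  shows "(LINT y|lborel. LINT x|measure_pmf P. f x y) = (LINT x|measure_pmf P. LINT y|lborel. f x y)"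
proof -
  have nb: "norm (LINT y|lborel. f x y) \<le> (LINT y|lborel. g y)" for x
    by (intro Bochner_Integration.integral_norm_bound_integral bd g
        Bochner_Integration.integrable_bound[OF g] AE_I2)
       (use order_trans[OF bd abs_ge_self] in auto)
  have "(LINT y|lborel. LINT x|measure_pmf P. f x y) = (LINT y|lborel. (\<Sum>\<^sub>\<infinity>x. complex_of_real (pmf P x) * f x y))"
    using has_sum_pmf[OF bd, THEN infsumI, symmetric] by (intro Bochner_Integration.integral_cong) auto
  also have "\<dots> = (\<Sum>\<^sub>\<infinity>x. (LINT y|lborel. complex_of_real (pmf P x) * f x y))"
  proof (rule integral_infsum_swap[where b = "pmf P" and g = g])
    show "pmf P summable_on UNIV"
      using integrable_pmf[of UNIV P]
      by (intro abs_summable_summable[OF iffD2[OF abs_summable_equivalent]]) (simp add: abs_summable_on_def)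
    show "norm (complex_of_real (pmf P x) * f x y) \<le> pmf P x * g y" for x y
      using bd by (simp add: norm_mult mult_left_mono)
  qed (auto simp: g)
  also have "\<dots> = (\<Sum>\<^sub>\<infinity>x. complex_of_real (pmf P x) * (LINT y|lborel. f x y))"
    by simp
  also have "\<dots> = (LINT x|measure_pmf P. LINT y|lborel. f x y)"
    by (rule has_sum_pmf[OF nb, THEN infsumI])
  finally show ?thesis .
qed

section \<open>A random walk whose characteristic function gives the lattice symbol\<close>

definition of_int_vec :: "int^'d \<Rightarrow> real^'d" where
  "of_int_vec n = (\<chi> p. real_of_int (n $ p))"

lemma of_int_vec_simps [simp]:
  "of_int_vec 0 = 0" "of_int_vec (m + n) = of_int_vec m + of_int_vec n"
  "of_int_vec (m - n) = of_int_vec m - of_int_vec n"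
  "of_int_vec (axis p k) = axis p (real_of_int k)"
  by (simp_all add: of_int_vec_def vec_eq_iff axis_def)

lemma of_int_vec_eq_iff [simp]: "of_int_vec m = of_int_vec n \<longleftrightarrow> m = n"
  by (simp add: of_int_vec_def vec_eq_iff)

definition lattice_symbol :: "real^'d \<Rightarrow> real" where
  "lattice_symbol \<eta> = (\<Sum>p\<in>UNIV. 4 * (sin (\<eta> $ p / 2))\<^sup>2)"

definition mean_cos :: "real^'d \<Rightarrow> real" where
  "mean_cos \<eta> = (\<Sum>p\<in>UNIV. cos (\<eta> $ p)) / CARD('d)"

lemma abs_mean_cos_le_1: "\<bar>mean_cos (\<eta> :: real^'d)\<bar> \<le> 1"
proof -
  have "\<bar>\<Sum>p\<in>UNIV. cos (\<eta> $ p)\<bar> \<le> (\<Sum>p\<in>(UNIV :: 'd set). 1)"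
    by (rule order_trans[OF sum_abs sum_mono]) simp
  then show ?thesis
    by (simp add: mean_cos_def divide_le_eq)
qed

lemma lattice_symbol_eq: "lattice_symbol (\<eta> :: real^'d) = 2 * CARD('d) * (1 - mean_cos \<eta>)"
proof -
  have "4 * (sin (t / 2))\<^sup>2 = 2 * (1 - cos t)" for t :: real
    using cos_double_sin[of "t / 2"] by simp
  then have "lattice_symbol \<eta> = (\<Sum>p\<in>UNIV. 2 * (1 - cos (\<eta> $ p)))"
    unfolding lattice_symbol_def by simp
  also have "\<dots> = 2 * (CARD('d) - (\<Sum>p\<in>UNIV. cos (\<eta> $ p)))"
    by (simp add: sum_subtractf flip: sum_distrib_left)
  finally show ?thesis
    by (simp add: mean_cos_def right_diff_distrib)
qed

text \<open>The position of the simple random walk on the integer lattice after \<open>k\<close> steps; the boolean is the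
  sign of the step.\<close>
primrec lattice_walk :: "nat \<Rightarrow> (int^'d) pmf" where
  "lattice_walk 0 = return_pmf 0"
| "lattice_walk (Suc k) = bind_pmf (lattice_walk k)
     (\<lambda>x. map_pmf (\<lambda>(p, b). x + axis p (if b then 1 else - 1)) (pmf_of_set UNIV))"

text \<open>Each step is uniform on the \<open>2 d\<close> unit vectors, and averages the plane wave to the mean cosine.\<close>
lemma lattice_walk_characteristic_function:
  "(LINT n|measure_pmf (lattice_walk k). iexp (\<eta> \<bullet> of_int_vec n)) = complex_of_real (mean_cos \<eta> ^ k)"
proof (induction k)
  case (Suc k)
  have step: "(LINT n|measure_pmf (map_pmf (\<lambda>(p, b). x + axis p (if b then 1 else - 1)) (pmf_of_set UNIV)).
      iexp (\<eta> \<bullet> of_int_vec n)) = iexp (\<eta> \<bullet> of_int_vec x) * complex_of_real (mean_cos \<eta>)" for x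
  proof -
    have "(LINT n|measure_pmf (map_pmf (\<lambda>(p, b). x + axis p (if b then 1 else - 1)) (pmf_of_set UNIV)).
        iexp (\<eta> \<bullet> of_int_vec n)) =
      (\<Sum>p\<in>UNIV. \<Sum>b\<in>UNIV. (1 / (2 * CARD('a))) *\<^sub>R (iexp (\<eta> \<bullet> of_int_vec x) * iexp (if b then \<eta> $ p else - \<eta> $ p)))"
      unfolding integral_map_pmf
      by (subst integral_measure_pmf[of UNIV])
         (auto simp: sum.cartesian_product inner_add_right distrib_left exp_add inner_axis
           card_cartesian_product mult.commute simp flip: UNIV_Times_UNIV intro!: sum.cong)
    also have "\<dots> = (\<Sum>p\<in>UNIV. iexp (\<eta> \<bullet> of_int_vec x) * complex_of_real (cos (\<eta> $ p) / CARD('a)))"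
    proof (rule sum.cong)
      fix p :: 'a
      have "iexp (\<eta> $ p) + iexp (- \<eta> $ p) = complex_of_real (2 * cos (\<eta> $ p))"
        by (simp add: complex_eq_iff Re_exp Im_exp)
      moreover have "(\<Sum>b\<in>UNIV. (1 / (2 * CARD('a))) *\<^sub>R (iexp (\<eta> \<bullet> of_int_vec x) * iexp (if b then \<eta> $ p else - \<eta> $ p))) =
          (1 / (2 * CARD('a))) *\<^sub>R (iexp (\<eta> \<bullet> of_int_vec x) * (iexp (\<eta> $ p) + iexp (- \<eta> $ p)))"
        unfolding UNIV_bool by (simp only: sum.insert sum.empty finite.intros scaleR_add_right distrib_left) simp
      ultimately show "(\<Sum>b\<in>UNIV. (1 / (2 * CARD('a))) *\<^sub>R (iexp (\<eta> \<bullet> of_int_vec x) * iexp (if b then \<eta> $ p else - \<eta> $ p))) =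
          iexp (\<eta> \<bullet> of_int_vec x) * complex_of_real (cos (\<eta> $ p) / CARD('a))"
        by (simp only:) (simp add: scaleR_conv_of_real)
    qed simp
    finally show ?thesis
      by (simp add: mean_cos_def sum_divide_distrib sum_distrib_left)
  qed
  have "(LINT n|measure_pmf (lattice_walk (Suc k)). iexp (\<eta> \<bullet> of_int_vec n)) =
      (LINT x|measure_pmf (lattice_walk k). iexp (\<eta> \<bullet> of_int_vec x) * complex_of_real (mean_cos \<eta>))"
    unfolding lattice_walk.simps by (subst integral_bind_pmf_complex[where B=1]) (simp_all only: step norm_exp_i_times order_refl)
  also have "\<dots> = complex_of_real (mean_cos \<eta> ^ Suc k)"
    using Suc by simp
  finally show ?case .
qed simp

text \<open>The simple random walk stopped after an independent random number of steps. By
  \<open>lattice_symbol_powr\<close> this is the jump distribution of the discrete fractional Laplacian.\<close>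
definition lattice_jump :: "real \<Rightarrow> (int^'d) pmf" where
  "lattice_jump \<theta> = bind_pmf (jump_count \<theta>) lattice_walk"

text \<open>The representation on which the treatment of the discrete operator rests: the fractional power of the
  lattice symbol is an absolutely convergent Fourier series whose coefficients are, up to a factor, a point
  mass at 0 minus a probability distribution.\<close>
lemma lattice_symbol_powr:
  fixes \<eta> :: "real^'d"
  assumes \<theta>: "0 < \<theta>" "\<theta> < 1"
  shows "complex_of_real (lattice_symbol \<eta> powr \<theta>) = complex_of_real ((2 * CARD('d)) powr \<theta>) *
    (1 - (LINT n|measure_pmf (lattice_jump \<theta>). iexp (\<eta> \<bullet> of_int_vec n)))"
proof -
  have "(LINT n|measure_pmf (lattice_jump \<theta>). iexp (\<eta> \<bullet> of_int_vec n)) =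
      (LINT k|measure_pmf (jump_count \<theta>). complex_of_real (mean_cos \<eta> ^ k))"
    unfolding lattice_jump_def
    by (subst integral_bind_pmf_complex[where B=1]) (simp_all only: lattice_walk_characteristic_function norm_exp_i_times order_refl)
  also have "\<dots> = complex_of_real (1 - (1 - mean_cos \<eta>) powr \<theta>)"
    by (rule jump_count_generating_function[OF \<theta> abs_mean_cos_le_1])
  finally have "1 - (LINT n|measure_pmf (lattice_jump \<theta>). iexp (\<eta> \<bullet> of_int_vec n)) =
      complex_of_real ((1 - mean_cos \<eta>) powr \<theta>)"
    by simp
  moreover have "lattice_symbol \<eta> powr \<theta> = (2 * CARD('d)) powr \<theta> * (1 - mean_cos \<eta>) powr \<theta>"
    using abs_mean_cos_le_1[of \<eta>] by (simp add: lattice_symbol_eq powr_mult)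
  ultimately show ?thesis by simp
qed

section \<open>Orthogonality of the characters of the torus\<close>

lemma fourier_orthogonality_real:
  "has_bochner_integral lborel (\<lambda>t. indicator {- pi..pi} t *\<^sub>R iexp (t * real_of_int k)) (if k = 0 then 2 * pi else 0)"
proof (cases "k = 0")
  case True
  have "has_bochner_integral lborel (\<lambda>t. indicator {- pi..pi} t *\<^sub>R (1::complex)) (measure lborel {- pi..pi} *\<^sub>R 1)"
    by (rule has_bochner_integral_indicator) auto
  then show ?thesis using True by (simp add: scaleR_conv_of_real)
next
  case False
  let ?F = "\<lambda>t::real. iexp (t * real_of_int k) / (\<i> * of_int k)"
  have "has_bochner_integral lborel (\<lambda>t. indicator {- pi..pi} t *\<^sub>R iexp (t * real_of_int k)) (?F pi - ?F (- pi))"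
  proof (rule has_bochner_integral_FTC_Icc)
    show "(?F has_vector_derivative iexp (t * real_of_int k)) (at t within {- pi..pi})" for t
    proof -
      have "((\<lambda>z. exp (\<i> * (z * of_int k))) has_field_derivative exp (\<i> * (of_real t * of_int k)) * (\<i> * of_int k)) (at (of_real t))"
        by (auto intro!: derivative_eq_intros)
      from DERIV_cdivide[OF this, of "\<i> * of_int k"]
      have "((\<lambda>z. exp (\<i> * (z * of_int k)) / (\<i> * of_int k)) has_field_derivative exp (\<i> * (of_real t * of_int k))) (at (of_real t))"
        using False by simp
      from has_vector_derivative_real_field[OF this] show ?thesis
        by (auto intro: has_vector_derivative_at_within)
    qed
    show "continuous_on {- pi..pi} (\<lambda>t. iexp (t * real_of_int k))"
      by (intro continuous_intros)
  qed simp
  moreover have "iexp (pi * real_of_int k) = iexp (- pi * real_of_int k)"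
  proof -
    have "sin (pi * real_of_int k) = 0"
      using sin_zero_iff_int2 by (metis mult.commute)
    then show ?thesis
      by (simp add: complex_eq_iff Re_exp Im_exp)
  qed
  ultimately show ?thesis using False by simp
qed

lemma fourier_orthogonality:
  fixes n :: "int^'d"
  shows "(LINT \<eta>:cbox (\<chi> p. - pi) (\<chi> p. pi)|lborel. iexp (\<eta> \<bullet> of_int_vec n)) =
    (if n = 0 then complex_of_real ((2 * pi) ^ CARD('d)) else 0)"
proof -
  let ?Q = "cbox (\<chi> p. - pi) (\<chi> p. pi) :: (real^'d) set"
  let ?k = "\<lambda>b::real^'d. \<lfloor>of_int_vec n \<bullet> b\<rfloor>"
  let ?g = "\<lambda>b t. indicator {- pi..pi} t *\<^sub>R iexp (t * real_of_int (?k b))"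
  have k: "of_int_vec n \<bullet> b = real_of_int (?k b)" if "b \<in> Basis" for b
    using that by (auto simp: Basis_vec_def of_int_vec_def inner_axis)
  have eq: "indicator ?Q \<eta> *\<^sub>R iexp (\<eta> \<bullet> of_int_vec n) = (\<Prod>b\<in>Basis. ?g b (\<eta> \<bullet> b))" for \<eta> :: "real^'d"
  proof -
    have "indicator ?Q \<eta> = (\<Prod>b\<in>Basis. indicator {- pi..pi} (\<eta> \<bullet> b) :: real)"
    proof (cases "\<eta> \<in> ?Q")
      case True
      then have "(\<Prod>b\<in>Basis. indicator {- pi..pi} (\<eta> \<bullet> b) :: real) = (\<Prod>b\<in>(Basis :: (real^'d) set). 1)"
        by (intro prod.cong) (auto simp: mem_box Basis_vec_def inner_axis)
      then show ?thesis using True by simp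
    next
      case False
      then obtain p where "\<eta> $ p \<notin> {- pi..pi}"
        by (auto simp: mem_box_cart)
      then have "\<exists>b\<in>Basis. indicator {- pi..pi} (\<eta> \<bullet> b) = (0::real)"
        by (intro bexI[of _ "axis p 1"]) (auto simp: inner_axis axis_in_Basis_iff)
      then show ?thesis using False by (subst prod_zero) auto
    qed
    moreover have "\<eta> \<bullet> of_int_vec n = (\<Sum>b\<in>Basis. (\<eta> \<bullet> b) * real_of_int (?k b))"
      by (rule trans[OF euclidean_inner]) (intro sum.cong refl arg_cong2[where f="(*)"] k)
    ultimately show ?thesis
      by (simp add: prod.distrib exp_sum sum_distrib_left scaleR_conv_of_real)
  qed
  have "(LINT \<eta>:?Q|lborel. iexp (\<eta> \<bullet> of_int_vec n)) = (\<Prod>b\<in>Basis. LINT t|lborel. ?g b t)"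
    unfolding set_lebesgue_integral_def eq
    by (rule integral_lborel_prod) (rule conjunct1[OF fourier_orthogonality_real[unfolded has_bochner_integral_iff]])
  also have "\<dots> = (\<Prod>b\<in>(Basis :: (real^'d) set). if ?k b = 0 then complex_of_real (2 * pi) else 0)"
    unfolding has_bochner_integral_integral_eq[OF fourier_orthogonality_real] by (intro prod.cong) auto
  also have "\<dots> = (if n = 0 then complex_of_real ((2 * pi) ^ CARD('d)) else 0)"
  proof (cases "n = 0")
    case False
    then obtain p where p: "n $ p \<noteq> 0"
      by (auto simp: vec_eq_iff)
    have "axis p 1 \<in> (Basis :: (real^'d) set)" "?k (axis p 1) \<noteq> 0"
      using p by (auto simp: axis_in_Basis_iff of_int_vec_def inner_axis)
    then have "\<exists>b\<in>Basis. (if ?k b = 0 then complex_of_real (2 * pi) else 0) = 0"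
      by (intro bexI[of _ "axis p 1"]) auto
    then show ?thesis using False by (subst prod_zero) auto
  qed simp
  finally show ?thesis .
qed

section \<open>The discrete operator as a Fourier multiplier\<close>

text \<open>The coefficients of the absolutely convergent series in \<open>lattice_symbol_powr\<close> are recovered by
  orthogonality, after exchanging the expectation with the integral over the torus. In particular the
  coefficients are absolutely summable.\<close>
lemma frac_coeff_of_int_vec:
  fixes n :: "int^'d"
  assumes a: "0 < a" "a < 2"
  shows "frac_coeff a (of_int_vec n) = complex_of_real ((2 * CARD('d)) powr (a / 2)) *
    ((if n = 0 then 1 else 0) - complex_of_real (pmf (lattice_jump (a / 2)) n))"
proof -
  define \<theta> where "\<theta> = a / 2"
  have \<theta>: "0 < \<theta>" "\<theta> < 1" using a by (auto simp: \<theta>_def)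
  let ?Q = "cbox (\<chi> p. - pi) (\<chi> p. pi) :: (real^'d) set"
  let ?P = "lattice_jump \<theta> :: (int^'d) pmf"
  define c where "c = complex_of_real ((2 * CARD('d)) powr \<theta>)"
  define C where "C = complex_of_real (1 / (2 * pi) ^ CARD('d))"
  let ?e = "\<lambda>m \<eta>. indicator ?Q \<eta> *\<^sub>R iexp (\<eta> \<bullet> of_int_vec m)"
  have Q: "?Q \<in> sets borel" by simp
  have em [measurable]: "?e m \<in> borel_measurable borel" for m
    by (rule borel_measurable_scaleR[OF borel_measurable_indicator[OF Q]]) measurable
  have iQ: "integrable lborel (\<lambda>\<eta>::real^'d. indicator ?Q \<eta> :: real)"
    by (rule integrable_real_indicator[OF _ emeasure_lborel_cbox_finite]) simp
  have ie: "integrable lborel (?e m)" for m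
    by (rule Bochner_Integration.integrable_bound[OF iQ em[folded measurable_lborel2]]) (auto simp: indicator_def)
  have orth: "C * (LINT \<eta>|lborel. ?e m \<eta>) = (if m = 0 then 1 else 0)" for m
    using fourier_orthogonality[of m] by (simp add: C_def set_lebesgue_integral_def)
  have eq: "indicator ?Q \<eta> *\<^sub>R (exp (- (\<i> * complex_of_real (\<eta> \<bullet> of_int_vec n))) * complex_of_real (lattice_symbol \<eta> powr \<theta>)) =
      c * (?e (- n) \<eta> - (LINT m|measure_pmf ?P. ?e (m - n) \<eta>))" for \<eta>
  proof -
    have "?e (m - n) \<eta> = indicator ?Q \<eta> *\<^sub>R exp (- (\<i> * complex_of_real (\<eta> \<bullet> of_int_vec n))) * iexp (\<eta> \<bullet> of_int_vec m)" for m
      by (simp add: inner_diff_right right_diff_distrib exp_diff exp_minus field_simps)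
    moreover have "?e (- n) \<eta> = indicator ?Q \<eta> *\<^sub>R exp (- (\<i> * complex_of_real (\<eta> \<bullet> of_int_vec n)))"
      using of_int_vec_simps(3)[of 0 n] by simp
    ultimately show ?thesis
      unfolding lattice_symbol_powr[OF \<theta>] c_def
      by (simp only: integral_mult_right_zero) (simp add: algebra_simps)
  qed
  have bdd: "norm (?e (m - n) \<eta>) \<le> indicator ?Q \<eta>" for m \<eta>
    by (simp add: indicator_def)
  have swap: "(LINT \<eta>|lborel. LINT m|measure_pmf ?P. ?e (m - n) \<eta>) = (LINT m|measure_pmf ?P. LINT \<eta>|lborel. ?e (m - n) \<eta>)"
    by (rule integral_expectation_swap[OF em bdd iQ])
  \<comment> \<open>Measurability of the expectation is read off from \<open>eq\<close>, solved for the expectation.\<close>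
  have iE: "integrable lborel (\<lambda>\<eta>. LINT m|measure_pmf ?P. ?e (m - n) \<eta>)"
  proof -
    have "(\<lambda>\<eta>. LINT m|measure_pmf ?P. ?e (m - n) \<eta>) = (\<lambda>\<eta>. ?e (- n) \<eta> -
        inverse c * (indicator ?Q \<eta> *\<^sub>R (exp (- (\<i> * complex_of_real (\<eta> \<bullet> of_int_vec n))) * complex_of_real (lattice_symbol \<eta> powr \<theta>))))"
    proof -
      have "c \<noteq> 0" by (simp add: c_def)
      then have "z = y - inverse c * (c * (y - z))" for y z
        by (simp add: field_simps)
      then show ?thesis unfolding eq by (intro ext)
    qed
    moreover have "(\<lambda>\<eta>. ?e (- n) \<eta> -
        inverse c * (indicator ?Q \<eta> *\<^sub>R (exp (- (\<i> * complex_of_real (\<eta> \<bullet> of_int_vec n))) * complex_of_real (lattice_symbol \<eta> powr \<theta>))))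
        \<in> borel_measurable borel"
      unfolding lattice_symbol_def
      by (intro borel_measurable_diff em borel_measurable_times borel_measurable_const borel_measurable_scaleR
          borel_measurable_indicator[OF Q]) measurable
    ultimately have "(\<lambda>\<eta>. LINT m|measure_pmf ?P. ?e (m - n) \<eta>) \<in> borel_measurable lborel"
      by (simp only: measurable_lborel2)
    then show ?thesis
    proof (rule Bochner_Integration.integrable_bound[OF iQ])
      show "AE \<eta> in lborel. norm (LINT m|measure_pmf ?P. ?e (m - n) \<eta>) \<le> norm (indicator ?Q \<eta> :: real)"
        using order_trans[OF norm_expectation_pmf_le[OF bdd] abs_ge_self] by (intro AE_I2) (simp only: real_norm_def)
    qed
  qed
  have "frac_coeff a (of_int_vec n) = C * (LINT \<eta>|lborel. c * (?e (- n) \<eta> - (LINT m|measure_pmf ?P. ?e (m - n) \<eta>)))"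
    unfolding frac_coeff_def set_lebesgue_integral_def lattice_symbol_def[symmetric]
      \<theta>_def[symmetric] C_def[symmetric] eq by (rule refl)
  also have "\<dots> = c * (C * (LINT \<eta>|lborel. ?e (- n) \<eta>) - (LINT m|measure_pmf ?P. C * (LINT \<eta>|lborel. ?e (m - n) \<eta>)))"
    unfolding integral_mult_right_zero swap[symmetric]
    by (subst Bochner_Integration.integral_diff[OF ie iE]) (simp add: algebra_simps)
  also have "\<dots> = c * ((if n = 0 then 1 else 0) - (LINT m|measure_pmf ?P. complex_of_real (indicator {n} m)))"
    unfolding orth by (simp add: indicator_def of_bool_def if_distrib[of complex_of_real] cong: if_cong)
  also have "(LINT m|measure_pmf ?P. complex_of_real (indicator {n} m)) = complex_of_real (pmf ?P n)"
    by (simp add: pmf.rep_eq)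
  finally show ?thesis unfolding c_def \<theta>_def .
qed

lemma grid_eq: "grid h = range (\<lambda>n::int^'d. h *\<^sub>R of_int_vec n)"
proof -
  have "(\<chi> p. real_of_int (j $ p) * h) = h *\<^sub>R of_int_vec j" for j :: "int^'d"
    by (simp add: of_int_vec_def vec_eq_iff)
  then show ?thesis unfolding grid_def by simp
qed

lemma countable_grid: "countable (grid h)"
  unfolding grid_eq by (rule countable_image) (rule countableI_type)

lemma bij_betw_grid:
  assumes h: "h > 0" and x: "x \<in> grid h"
  shows "bij_betw (\<lambda>n. x + h *\<^sub>R of_int_vec n) UNIV (grid h)"
proof (rule bij_betwI')
  obtain j where j: "x = h *\<^sub>R of_int_vec j"
    using x by (auto simp: grid_eq)
  have add: "x + h *\<^sub>R of_int_vec n = h *\<^sub>R of_int_vec (j + n)" for n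
    by (simp add: j scaleR_add_right)
  show "x + h *\<^sub>R of_int_vec n \<in> grid h" for n
    unfolding add grid_eq by (rule rangeI)
  show "\<exists>n\<in>UNIV. y = x + h *\<^sub>R of_int_vec n" if y: "y \<in> grid h" for y
  proof -
    obtain k where k: "y = h *\<^sub>R of_int_vec k"
      using y by (auto simp: grid_eq)
    show ?thesis
      by (rule bexI[of _ "k - j"]) (simp_all only: add k, simp_all)
  qed
qed (use h in auto)

lemma frac_coeff_grid_sum:
  fixes v :: "real^'d \<Rightarrow> real"
  assumes h: "h > 0" and x: "x \<in> grid h" and a: "0 < a" "a < 2"
    and b: "\<And>y. y \<in> grid h \<Longrightarrow> \<bar>v y\<bar> \<le> B"
  shows "(\<Sum>\<^sub>\<infinity>y\<in>grid h. frac_coeff a ((y - x) /\<^sub>R h) * complex_of_real (v y)) =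
    complex_of_real ((2 * CARD('d)) powr (a / 2)) *
    (complex_of_real (v x) - (LINT n|measure_pmf (lattice_jump (a / 2)). complex_of_real (v (x + h *\<^sub>R of_int_vec n))))"
proof (rule infsumI)
  let ?P = "lattice_jump (a / 2) :: (int^'d) pmf"
  let ?v = "\<lambda>n. complex_of_real (v (x + h *\<^sub>R of_int_vec n))"
  have bd: "norm (?v n) \<le> B" for n
    using b bij_betwE[OF bij_betw_grid[OF h x]] by auto
  have "((\<lambda>n::int^'d. if n = 0 then ?v n else 0) has_sum complex_of_real (v x)) UNIV"
    using has_sum_finite_neutralI[of "{0::int^'d}" UNIV "\<lambda>n. if n = 0 then ?v n else 0" "complex_of_real (v x)"] by simp
  from has_sum_cmult_right[OF has_sum_add[OF this has_sum_uminusI[OF has_sum_pmf[of ?v B ?P, OF bd]]], of "complex_of_real ((2 * CARD('d)) powr (a / 2))"]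
  have "((\<lambda>n. complex_of_real ((2 * CARD('d)) powr (a / 2)) * ((if n = 0 then ?v n else 0) - complex_of_real (pmf ?P n) * ?v n)) has_sum
      complex_of_real ((2 * CARD('d)) powr (a / 2)) * (complex_of_real (v x) - (LINT n|measure_pmf ?P. ?v n))) UNIV"
    by simp
  also have "(\<lambda>n. complex_of_real ((2 * CARD('d)) powr (a / 2)) * ((if n = 0 then ?v n else 0) - complex_of_real (pmf ?P n) * ?v n)) =
      (\<lambda>n. frac_coeff a (((x + h *\<^sub>R of_int_vec n) - x) /\<^sub>R h) * ?v n)"
    using h by (auto simp: frac_coeff_of_int_vec[OF a] algebra_simps fun_eq_iff)
  finally show "((\<lambda>y. frac_coeff a ((y - x) /\<^sub>R h) * complex_of_real (v y)) has_sum
      complex_of_real ((2 * CARD('d)) powr (a / 2)) * (complex_of_real (v x) - (LINT n|measure_pmf ?P. ?v n))) (grid h)"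
    by (subst (asm) has_sum_reindex_bij_betw[OF bij_betw_grid[OF h x],
          where f = "\<lambda>y. frac_coeff a ((y - x) /\<^sub>R h) * complex_of_real (v y)"])
qed

lemma symbol_h_eq: "symbol_h h \<xi> = lattice_symbol (h *\<^sub>R \<xi>) / h\<^sup>2"
  by (simp add: symbol_h_def lattice_symbol_def sum_divide_distrib mult.commute)

lemma lattice_symbol_nonneg: "lattice_symbol \<eta> \<ge> 0"
  unfolding lattice_symbol_def by (intro sum_nonneg) simp

lemma symbol_h_powr:
  assumes h: "h > 0"
  shows "symbol_h h \<xi> powr (a / 2) = h powr (- a) * lattice_symbol (h *\<^sub>R \<xi>) powr (a / 2)"
proof -
  have "h\<^sup>2 powr (a / 2) = h powr a"
    using h powr_powr[of h 2 "a / 2"] by simp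
  then show ?thesis
    by (simp add: symbol_h_eq powr_divide powr_minus_divide lattice_symbol_nonneg)
qed

lemma borel_measurable_symbol_h [measurable]: "symbol_h h \<in> borel_measurable borel"
  unfolding symbol_h_def by measurable

text \<open>The substitution \<open>\<eta> = h \<xi>\<close> carries the frequency box to the torus; the factor \<open>h^d\<close> of the discrete
  transform cancels the Jacobian. It identifies the contribution of a single grid value in the Fourier
  definition with the one in the definition by coefficients.\<close>
lemma frac_coeff_rescaled:
  fixes x y :: "real^'d"
  assumes h: "h > 0"
  shows "complex_of_real (1 / (2 * pi) ^ CARD('d)) * (LINT \<xi>:freq_box h|lborel. iexp (\<xi> \<bullet> x) *
      (complex_of_real (symbol_h h \<xi> powr (a / 2)) * (complex_of_real (h ^ CARD('d)) * exp (- (\<i> * complex_of_real (\<xi> \<bullet> y)))))) =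
    complex_of_real (h powr (- a)) * frac_coeff a ((y - x) /\<^sub>R h)"
proof -
  let ?Q = "cbox (\<chi> p. - pi) (\<chi> p. pi) :: (real^'d) set"
  let ?f = "\<lambda>\<xi>. indicator (freq_box h) \<xi> *\<^sub>R (iexp (\<xi> \<bullet> x) *
      (complex_of_real (symbol_h h \<xi> powr (a / 2)) * (complex_of_real (h ^ CARD('d)) * exp (- (\<i> * complex_of_real (\<xi> \<bullet> y))))))"
  let ?g = "\<lambda>\<eta>. indicator ?Q \<eta> *\<^sub>R (exp (- (\<i> * complex_of_real (\<eta> \<bullet> ((y - x) /\<^sub>R h)))) *
      complex_of_real (lattice_symbol \<eta> powr (a / 2)))"
  have fb: "freq_box h \<in> sets (borel :: (real^'d) measure)"
    by (simp add: freq_box_def)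
  have m: "?f \<in> borel_measurable borel"
    by (rule borel_measurable_scaleR[OF borel_measurable_indicator[OF fb]]) measurable
  have "(LINT \<xi>|lborel. ?f \<xi>) = (1 / h) ^ CARD('d) *\<^sub>R (LINT \<eta>|lborel. ?f (0 + (1 / h) *\<^sub>R \<eta>))"
    using h by (subst integral_lborel_affine[OF m, of "1 / h" 0]) auto
  also have "\<dots> = (1 / h) ^ CARD('d) *\<^sub>R (LINT \<eta>|lborel. complex_of_real (h ^ CARD('d) * h powr (- a)) * ?g \<eta>)"
  proof -
    have "?f (0 + (1 / h) *\<^sub>R \<eta>) = complex_of_real (h ^ CARD('d) * h powr (- a)) * ?g \<eta>" for \<eta>
    proof -
      have "(1 / h) *\<^sub>R \<eta> \<in> freq_box h \<longleftrightarrow> \<eta> \<in> ?Q"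
        using h by (simp add: freq_box_def mem_box_cart divide_le_cancel minus_divide_left del: minus_divide_left[symmetric])
      moreover have "iexp (((1 / h) *\<^sub>R \<eta>) \<bullet> x) * exp (- (\<i> * complex_of_real (((1 / h) *\<^sub>R \<eta>) \<bullet> y))) =
          exp (- (\<i> * complex_of_real (\<eta> \<bullet> ((y - x) /\<^sub>R h))))"
        unfolding exp_add[symmetric] by (simp add: inner_diff_right field_simps)
      moreover have "symbol_h h ((1 / h) *\<^sub>R \<eta>) powr (a / 2) = h powr (- a) * lattice_symbol \<eta> powr (a / 2)"
        using h by (simp add: symbol_h_powr)
      ultimately show ?thesis
        by (auto simp: indicator_def mult_ac)
    qed
    then show ?thesis by (simp only:)
  qed
  also have "\<dots> = complex_of_real (h powr (- a)) * (LINT \<eta>|lborel. ?g \<eta>)"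
    using h by (simp add: scaleR_conv_of_real power_divide)
  finally show ?thesis
    unfolding frac_coeff_def set_lebesgue_integral_def lattice_symbol_def by (simp only: mult.left_commute)
qed

text \<open>The two cases of the definition agree. In the absolutely convergent case the sum in the discrete
  transform may be taken out of the frequency integral, which yields the series with the coefficients.\<close>
lemma frac_lap_h_eq:
  fixes v :: "real^'d \<Rightarrow> real"
  assumes h: "h > 0" and x: "x \<in> grid h" and a: "0 < \<alpha> x" "\<alpha> x < 2"
    and b: "\<And>y. y \<in> grid h \<Longrightarrow> \<bar>v y\<bar> \<le> B"
  shows "frac_lap_h h \<alpha> v x = complex_of_real (h powr (- \<alpha> x) * (2 * CARD('d)) powr (\<alpha> x / 2)) *
    (complex_of_real (v x) - (LINT n|measure_pmf (lattice_jump (\<alpha> x / 2)). complex_of_real (v (x + h *\<^sub>R of_int_vec n))))"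
proof -
  define a' where "a' = \<alpha> x"
  let ?S = "\<Sum>\<^sub>\<infinity>y\<in>grid h. frac_coeff a' ((y - x) /\<^sub>R h) * complex_of_real (v y)"
  have "frac_lap_h h \<alpha> v x = complex_of_real (h powr (- a')) * ?S"
  proof (cases "\<forall>\<xi>. (\<lambda>y. norm (exp (- (\<i> * complex_of_real (\<xi> \<bullet> y))) * complex_of_real (v y))) summable_on grid h")
    case True
    from True have sv: "(\<lambda>y. \<bar>v y\<bar>) summable_on grid h"
      by (auto simp: norm_mult)
    define C where "C = complex_of_real (1 / (2 * pi) ^ CARD('d))"
    let ?w = "\<lambda>y \<xi>. indicator (freq_box h) \<xi> *\<^sub>R (iexp (\<xi> \<bullet> x) *
      (complex_of_real (symbol_h h \<xi> powr (a' / 2)) * (complex_of_real (h ^ CARD('d)) * exp (- (\<i> * complex_of_real (\<xi> \<bullet> y))))))"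
    let ?g = "\<lambda>\<xi>::real^'d. indicator (freq_box h) \<xi> *\<^sub>R (symbol_h h \<xi> powr (a' / 2) * h ^ CARD('d))"
    have fb: "freq_box h \<in> sets (borel :: (real^'d) measure)"
      by (simp add: freq_box_def)
    have ig: "integrable lborel ?g"
    proof (rule borel_integrable_compact)
      show "compact (freq_box h :: (real^'d) set)" by (simp add: freq_box_def)
      show "continuous_on (freq_box h) (\<lambda>\<xi>::real^'d. symbol_h h \<xi> powr (a' / 2) * h ^ CARD('d))"
        unfolding symbol_h_def using a by (intro continuous_intros continuous_on_powr') (auto simp: a'_def intro!: sum_nonneg)
    qed
    have m: "(\<lambda>\<xi>. ?w y \<xi> * complex_of_real (v y)) \<in> borel_measurable borel" for y
      by (intro borel_measurable_times borel_measurable_scaleR[OF borel_measurable_indicator[OF fb]]) measurable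
    have "frac_lap_h h \<alpha> v x = C * (LINT \<xi>|lborel. (\<Sum>\<^sub>\<infinity>y\<in>grid h. ?w y \<xi> * complex_of_real (v y)))"
    proof -
      have "indicator (freq_box h) \<xi> *\<^sub>R (iexp (\<xi> \<bullet> x) * (complex_of_real (symbol_h h \<xi> powr (a' / 2)) * fourier_h h v \<xi>)) =
          (\<Sum>\<^sub>\<infinity>y\<in>grid h. ?w y \<xi> * complex_of_real (v y))" for \<xi>
        unfolding fourier_h_def scaleR_conv_of_real by (simp only: infsum_cmult_right'[symmetric] mult.assoc)
      then show ?thesis
        using True unfolding frac_lap_h_def inv_fourier_h_def set_lebesgue_integral_def C_def a'_def by simp
    qed
    also have "(LINT \<xi>|lborel. (\<Sum>\<^sub>\<infinity>y\<in>grid h. ?w y \<xi> * complex_of_real (v y))) =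
        (\<Sum>\<^sub>\<infinity>y\<in>grid h. (LINT \<xi>|lborel. ?w y \<xi> * complex_of_real (v y)))"
    proof (rule integral_infsum_swap[where b = "\<lambda>y. \<bar>v y\<bar>" and g = ?g])
      show "norm (?w y \<xi> * complex_of_real (v y)) \<le> \<bar>v y\<bar> * ?g \<xi>" for y \<xi>
        using h by (simp add: norm_mult norm_power indicator_def mult_ac)
    qed (simp_all only: countable_grid m sv ig abs_ge_zero)
    also have "C * \<dots> = (\<Sum>\<^sub>\<infinity>y\<in>grid h. (C * (LINT \<xi>|lborel. ?w y \<xi>)) * complex_of_real (v y))"
      by (simp only: infsum_cmult_right'[symmetric] integral_mult_left_zero mult.assoc)
    also have "\<dots> = complex_of_real (h powr (- a')) * ?S"
      using frac_coeff_rescaled[OF h, of x a'] unfolding C_def set_lebesgue_integral_def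
      by (simp only: infsum_cmult_right'[symmetric] mult.assoc)
    finally show ?thesis .
  next
    case False
    then show ?thesis unfolding frac_lap_h_def a'_def by (simp only: if_False)
  qed
  also have "?S = complex_of_real ((2 * CARD('d)) powr (a' / 2)) *
      (complex_of_real (v x) - (LINT n|measure_pmf (lattice_jump (a' / 2)). complex_of_real (v (x + h *\<^sub>R of_int_vec n))))"
    using a unfolding a'_def by (intro frac_coeff_grid_sum[OF h x _ _ b])
  finally show ?thesis
    unfolding a'_def by (simp add: mult.assoc)
qed

text \<open>Inserting plane waves into \<open>frac_lap_h_eq\<close> turns the random displacement \<open>h X\<close> into the factor
  \<open>E exp (i h \<xi> \<bullet> X)\<close>, and \<open>lattice_symbol_powr\<close> evaluates it. The integral runs over all frequencies, on
  which the symbol is periodic: this is how aliasing enters.\<close>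
lemma frac_lap_h_fourier:
  fixes u :: "real^'d \<Rightarrow> real"
  assumes u: "integrable lborel u" and cont: "continuous_on UNIV u"
    and F: "integrable lborel (fourier u)"
    and h: "h > 0" and x: "x \<in> grid h" and a: "0 < \<alpha> x" "\<alpha> x < 2"
  shows "frac_lap_h h \<alpha> (restrict u (grid h)) x = complex_of_real (1 / (2 * pi) ^ CARD('d)) *
    (LINT \<xi>|lborel. iexp (\<xi> \<bullet> x) * fourier u \<xi> * complex_of_real (symbol_h h \<xi> powr (\<alpha> x / 2)))"
proof -
  define C where "C = complex_of_real (1 / (2 * pi) ^ CARD('d))"
  define k where "k = complex_of_real (h powr (- \<alpha> x) * (2 * CARD('d)) powr (\<alpha> x / 2))"
  define \<theta> where "\<theta> = \<alpha> x / 2"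
  have \<theta>: "0 < \<theta>" "\<theta> < 1" using a by (auto simp: \<theta>_def)
  let ?P = "lattice_jump \<theta> :: (int^'d) pmf"
  have [measurable]: "u \<in> borel_measurable borel"
    using u by auto
  have inv: "complex_of_real (u y) = C * (LINT \<xi>|lborel. iexp (\<xi> \<bullet> y) * fourier u \<xi>)" for y
    unfolding C_def by (rule fourier_inversion[OF u cont F])
  have inF: "integrable lborel (\<lambda>\<xi>. norm (fourier u \<xi>))"
    using F by (rule integrable_norm)
  have I: "integrable lborel (\<lambda>\<xi>. iexp (\<xi> \<bullet> y) * fourier u \<xi>)" for y
    by (rule Bochner_Integration.integrable_bound[OF F]) (auto simp: norm_mult)
  have bdd: "\<bar>u y\<bar> \<le> norm C * (LINT \<xi>|lborel. norm (fourier u \<xi>))" for y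
  proof -
    have "norm (complex_of_real (u y)) \<le> norm C * (LINT \<xi>|lborel. norm (iexp (\<xi> \<bullet> y) * fourier u \<xi>))"
      unfolding inv norm_mult[of C] by (intro mult_left_mono integral_norm_bound) simp
    then show ?thesis by (simp add: norm_mult)
  qed
  have "frac_lap_h h \<alpha> (restrict u (grid h)) x =
      k * (complex_of_real (u x) - (LINT n|measure_pmf ?P. complex_of_real (u (x + h *\<^sub>R of_int_vec n))))"
    using frac_lap_h_eq[where \<alpha> = \<alpha> and B = "norm C * (LINT \<xi>|lborel. norm (fourier u \<xi>))", OF h x a, of "restrict u (grid h)"] bdd x bij_betwE[OF bij_betw_grid[OF h x]]
    by (simp add: k_def \<theta>_def)
  also have "(LINT n|measure_pmf ?P. complex_of_real (u (x + h *\<^sub>R of_int_vec n))) =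
      C * (LINT n|measure_pmf ?P. (LINT \<xi>|lborel. iexp (\<xi> \<bullet> (x + h *\<^sub>R of_int_vec n)) * fourier u \<xi>))"
    unfolding inv by simp
  also have "(LINT n|measure_pmf ?P. (LINT \<xi>|lborel. iexp (\<xi> \<bullet> (x + h *\<^sub>R of_int_vec n)) * fourier u \<xi>)) =
      (LINT \<xi>|lborel. LINT n|measure_pmf ?P. iexp (\<xi> \<bullet> (x + h *\<^sub>R of_int_vec n)) * fourier u \<xi>)"
    by (rule integral_expectation_swap[symmetric, OF _ _ inF]) (auto simp: norm_mult)
  also have "\<dots> = (LINT \<xi>|lborel. iexp (\<xi> \<bullet> x) * fourier u \<xi> * (LINT n|measure_pmf ?P. iexp ((h *\<^sub>R \<xi>) \<bullet> of_int_vec n)))"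
    by (simp only: integral_mult_right_zero[symmetric] inner_add_right of_real_add distrib_left exp_add
        inner_scaleR_left inner_scaleR_right mult.assoc mult.commute[of _ "fourier u _"] mult.left_commute[of _ "fourier u _"])
  finally have L: "frac_lap_h h \<alpha> (restrict u (grid h)) x = k * (C * (LINT \<xi>|lborel. iexp (\<xi> \<bullet> x) * fourier u \<xi>) -
      C * (LINT \<xi>|lborel. iexp (\<xi> \<bullet> x) * fourier u \<xi> * (LINT n|measure_pmf ?P. iexp ((h *\<^sub>R \<xi>) \<bullet> of_int_vec n))))"
    unfolding inv .
  have sym: "complex_of_real (symbol_h h \<xi> powr \<theta>) = k * (1 - (LINT n|measure_pmf ?P. iexp ((h *\<^sub>R \<xi>) \<bullet> of_int_vec n)))" for \<xi>
    unfolding symbol_h_powr[OF h, of \<xi> "\<alpha> x", folded \<theta>_def] of_real_mult lattice_symbol_powr[OF \<theta>] k_def \<theta>_def[symmetric]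
    by (simp add: mult.assoc)
  have k0: "k \<noteq> 0" using h by (simp add: k_def)
  then have E: "(LINT n|measure_pmf ?P. iexp ((h *\<^sub>R \<xi>) \<bullet> of_int_vec n)) = 1 - complex_of_real (symbol_h h \<xi> powr \<theta>) / k" for \<xi>
    unfolding sym by simp
  \<comment> \<open>Again the symbol formula, solved for the expectation, supplies measurability.\<close>
  have J: "integrable lborel (\<lambda>\<xi>. iexp (\<xi> \<bullet> x) * fourier u \<xi> * (LINT n|measure_pmf ?P. iexp ((h *\<^sub>R \<xi>) \<bullet> of_int_vec n)))"
  proof (rule Bochner_Integration.integrable_bound[OF inF])
    show "(\<lambda>\<xi>. iexp (\<xi> \<bullet> x) * fourier u \<xi> * (LINT n|measure_pmf ?P. iexp ((h *\<^sub>R \<xi>) \<bullet> of_int_vec n))) \<in> borel_measurable lborel"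
      unfolding E by measurable
    show "AE \<xi> in lborel. norm (iexp (\<xi> \<bullet> x) * fourier u \<xi> * (LINT n|measure_pmf ?P. iexp ((h *\<^sub>R \<xi>) \<bullet> of_int_vec n))) \<le> norm (norm (fourier u \<xi>))"
    proof (intro AE_I2)
      fix \<xi> :: "real^'d"
      have "norm (LINT n|measure_pmf ?P. iexp ((h *\<^sub>R \<xi>) \<bullet> of_int_vec n)) \<le> 1"
        by (rule norm_expectation_pmf_le) simp
      then show "norm (iexp (\<xi> \<bullet> x) * fourier u \<xi> * (LINT n|measure_pmf ?P. iexp ((h *\<^sub>R \<xi>) \<bullet> of_int_vec n))) \<le> norm (norm (fourier u \<xi>))"
        by (simp add: norm_mult mult_left_le)
    qed
  qed
  have "frac_lap_h h \<alpha> (restrict u (grid h)) x = C * (LINT \<xi>|lborel. k * (iexp (\<xi> \<bullet> x) * fourier u \<xi> -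
      iexp (\<xi> \<bullet> x) * fourier u \<xi> * (LINT n|measure_pmf ?P. iexp ((h *\<^sub>R \<xi>) \<bullet> of_int_vec n))))"
    unfolding L integral_mult_right_zero Bochner_Integration.integral_diff[OF I J] by (simp only: right_diff_distrib mult.left_commute)
  also have "\<dots> = C * (LINT \<xi>|lborel. iexp (\<xi> \<bullet> x) * fourier u \<xi> * complex_of_real (symbol_h h \<xi> powr \<theta>))"
  proof -
    have "k * (y - y * z) = y * (k * (1 - z))" for y z
      by (simp add: algebra_simps)
    then show ?thesis unfolding sym by (simp only:)
  qed
  finally show ?thesis unfolding C_def \<theta>_def .
qed

section \<open>Comparison of the symbols\<close>

text \<open>Factor the difference of squares and use the cubic Taylor bound for the sine.\<close>
lemma sin_squared_lower_bound: "(x::real)\<^sup>2 - (sin x)\<^sup>2 \<le> x ^ 4"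
proof -
  have sum3: "(\<Sum>m<3. sin_coeff m * x ^ m) = x"
    by (simp add: eval_nat_numeral sin_coeff_def)
  have "\<bar>sin x - x\<bar> \<le> \<bar>x\<bar> ^ 3 / 6"
    using Maclaurin_sin_bound[of x 3] unfolding sum3 by (simp add: fact_numeral)
  then have "\<bar>x\<bar> - \<bar>sin x\<bar> \<le> \<bar>x\<bar> ^ 3 / 6"
    by linarith
  moreover have "\<bar>x\<bar> + \<bar>sin x\<bar> \<le> 2 * \<bar>x\<bar>"
    using abs_sin_x_le_abs_x[of x] by simp
  ultimately have "(\<bar>x\<bar> - \<bar>sin x\<bar>) * (\<bar>x\<bar> + \<bar>sin x\<bar>) \<le> (\<bar>x\<bar> ^ 3 / 6) * (2 * \<bar>x\<bar>)"
    by (intro mult_mono) auto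
  also have "(\<bar>x\<bar> - \<bar>sin x\<bar>) * (\<bar>x\<bar> + \<bar>sin x\<bar>) = x\<^sup>2 - (sin x)\<^sup>2"
    by (simp add: algebra_simps power2_eq_square)
  also have "(\<bar>x\<bar> ^ 3 / 6) * (2 * \<bar>x\<bar>) = \<bar>x\<bar> ^ 4 / 3"
    by (simp add: eval_nat_numeral)
  also have "\<bar>x\<bar> ^ 4 / 3 \<le> x ^ 4"
    by simp
  finally show ?thesis .
qed

lemma symbol_h_bounds:
  fixes \<xi> :: "real^'d"
  assumes h: "h > 0"
  shows "0 \<le> symbol_h h \<xi>" "symbol_h h \<xi> \<le> (norm \<xi>)\<^sup>2"
    and "(norm \<xi>)\<^sup>2 - symbol_h h \<xi> \<le> (h * norm \<xi>)\<^sup>2 * (norm \<xi>)\<^sup>2"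
proof -
  have sq: "(norm \<xi>)\<^sup>2 = (\<Sum>p\<in>UNIV. (\<xi> $ p)\<^sup>2)"
    unfolding power2_norm_eq_inner by (simp add: inner_vec_def power2_eq_square)
  have sc: "4 / h\<^sup>2 * (\<xi> $ p * h / 2)\<^sup>2 = (\<xi> $ p)\<^sup>2" for p
    using h by (simp add: field_simps power2_eq_square)
  show "0 \<le> symbol_h h \<xi>"
    unfolding symbol_h_def by (intro sum_nonneg) simp
  show "symbol_h h \<xi> \<le> (norm \<xi>)\<^sup>2"
    unfolding symbol_h_def sq
  proof (rule sum_mono)
    fix p
    have "(sin (\<xi> $ p * h / 2))\<^sup>2 \<le> (\<xi> $ p * h / 2)\<^sup>2"
      using abs_sin_x_le_abs_x[of "\<xi> $ p * h / 2"] unfolding abs_le_square_iff .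
    then have "4 / h\<^sup>2 * (sin (\<xi> $ p * h / 2))\<^sup>2 \<le> 4 / h\<^sup>2 * (\<xi> $ p * h / 2)\<^sup>2"
      by (rule mult_left_mono) simp
    then show "4 / h\<^sup>2 * (sin (\<xi> $ p * h / 2))\<^sup>2 \<le> (\<xi> $ p)\<^sup>2"
      unfolding sc .
  qed
  have "(norm \<xi>)\<^sup>2 - symbol_h h \<xi> = (\<Sum>p\<in>UNIV. 4 / h\<^sup>2 * ((\<xi> $ p * h / 2)\<^sup>2 - (sin (\<xi> $ p * h / 2))\<^sup>2))"
    unfolding symbol_h_def sq right_diff_distrib sc by (simp add: sum_subtractf)
  also have "\<dots> \<le> (\<Sum>p\<in>UNIV. h\<^sup>2 * ((norm \<xi>)\<^sup>2 * (\<xi> $ p)\<^sup>2))"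
  proof (rule sum_mono)
    fix p
    have "(\<xi> $ p)\<^sup>2 \<le> (norm \<xi>)\<^sup>2"
      unfolding sq by (intro member_le_sum) auto
    then have "(\<xi> $ p)\<^sup>2 * (\<xi> $ p)\<^sup>2 \<le> (norm \<xi>)\<^sup>2 * (\<xi> $ p)\<^sup>2"
      by (rule mult_right_mono) simp
    moreover have "0 \<le> (\<xi> $ p)\<^sup>2 * (\<xi> $ p)\<^sup>2" by simp
    ultimately have le: "(\<xi> $ p)\<^sup>2 * (\<xi> $ p)\<^sup>2 / 4 \<le> (norm \<xi>)\<^sup>2 * (\<xi> $ p)\<^sup>2"
      by linarith
    have "4 / h\<^sup>2 * ((\<xi> $ p * h / 2)\<^sup>2 - (sin (\<xi> $ p * h / 2))\<^sup>2) \<le> 4 / h\<^sup>2 * (\<xi> $ p * h / 2) ^ 4"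
      by (intro mult_left_mono sin_squared_lower_bound) simp
    also have "\<dots> = h\<^sup>2 * ((\<xi> $ p)\<^sup>2 * (\<xi> $ p)\<^sup>2 / 4)"
      using h by (simp add: field_simps eval_nat_numeral)
    also have "\<dots> \<le> h\<^sup>2 * ((norm \<xi>)\<^sup>2 * (\<xi> $ p)\<^sup>2)"
      using le by (rule mult_left_mono) simp
    finally show "4 / h\<^sup>2 * ((\<xi> $ p * h / 2)\<^sup>2 - (sin (\<xi> $ p * h / 2))\<^sup>2) \<le> h\<^sup>2 * ((norm \<xi>)\<^sup>2 * (\<xi> $ p)\<^sup>2)" .
  qed
  also have "\<dots> = (h * norm \<xi>)\<^sup>2 * (norm \<xi>)\<^sup>2"
    unfolding sum_distrib_left[symmetric] sq[symmetric] by (simp add: power_mult_distrib)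
  finally show "(norm \<xi>)\<^sup>2 - symbol_h h \<xi> \<le> (h * norm \<xi>)\<^sup>2 * (norm \<xi>)\<^sup>2" .
qed

text \<open>Write the discrete symbol as \<open>|\<xi>|^a q^(a/2)\<close> with a ratio \<open>q\<close> between \<open>1 - r^2\<close> and 1, where \<open>r = h |\<xi>|\<close>.
  Since \<open>a / 2 < 1\<close> one has \<open>q \<le> q^(a/2) \<le> 1\<close>, and the relative error is at most \<open>min (1, r^2) \<le> r^s\<close>. The
  bound 1 covers the frequencies with \<open>r \<ge> 1\<close>, and the bound \<open>r^2\<close> the others.\<close>
lemma symbol_error:
  fixes \<xi> :: "real^'d"
  assumes h: "h > 0" and a: "0 < a" "a < 2" and s: "0 < s" "s \<le> 2"
  shows "\<bar>norm \<xi> powr a - symbol_h h \<xi> powr (a / 2)\<bar> \<le> h powr s * norm \<xi> powr (a + s)"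
proof (cases "\<xi> = 0")
  case True
  then show ?thesis by (simp add: symbol_h_def)
next
  case False
  define A where "A = (norm \<xi>)\<^sup>2"
  define q where "q = symbol_h h \<xi> / A"
  define r where "r = h * norm \<xi>"
  have A: "A > 0" and r: "r > 0"
    using False h by (auto simp: A_def r_def)
  have q: "0 \<le> q" "q \<le> 1" "1 - q \<le> r\<^sup>2"
    using symbol_h_bounds[OF h, of \<xi>] A by (auto simp: q_def A_def r_def field_simps)
  have Aa: "A powr (a / 2) = norm \<xi> powr a"
    unfolding A_def using False powr_powr[of "norm \<xi>" 2 "a / 2"] by simp
  have "q powr 1 \<le> q powr (a / 2)"
    using q a by (intro powr_mono') auto
  then have qa: "1 - q powr (a / 2) \<le> r\<^sup>2" "1 - q powr (a / 2) \<le> 1"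
    using q by auto
  have "1 - q powr (a / 2) \<le> r powr s"
  proof (cases "r \<le> 1")
    case True
    then have "r powr 2 \<le> r powr s"
      using r s by (intro powr_mono') auto
    then show ?thesis using qa r by simp
  next
    case False
    then have "1 \<le> r powr s"
      using s by (intro ge_one_powr_ge_zero) auto
    with qa(2) show ?thesis by (rule order_trans)
  qed
  moreover have "0 \<le> 1 - q powr (a / 2)"
    using q a by (simp add: powr_le1)
  ultimately have "\<bar>1 - q powr (a / 2)\<bar> \<le> r powr s" by simp
  have "symbol_h h \<xi> = A * q" using A by (simp add: q_def)
  then have sq: "symbol_h h \<xi> powr (a / 2) = norm \<xi> powr a * q powr (a / 2)"
    using A q by (simp add: powr_mult Aa)
  have "\<bar>norm \<xi> powr a - symbol_h h \<xi> powr (a / 2)\<bar> = norm \<xi> powr a * \<bar>1 - q powr (a / 2)\<bar>"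
  proof -
    have "norm \<xi> powr a - norm \<xi> powr a * q powr (a / 2) = norm \<xi> powr a * (1 - q powr (a / 2))"
      by (simp add: right_diff_distrib)
    then show ?thesis
      unfolding sq by (simp add: abs_mult)
  qed
  also have "\<dots> \<le> norm \<xi> powr a * r powr s"
    using \<open>\<bar>1 - q powr (a / 2)\<bar> \<le> r powr s\<close> by (rule mult_left_mono) simp
  also have "\<dots> = h powr s * norm \<xi> powr (a + s)"
    using h by (simp add: r_def powr_mult powr_add)
  finally show ?thesis .
qed

lemma powr_le_one_plus_powr:
  fixes r :: real
  assumes "r \<ge> 0" "0 \<le> a" "a \<le> t"
  shows "r powr a \<le> 1 + r powr t"
proof (cases "r \<le> 1")
  case True
  then show ?thesis using assms powr_le1[of a r] by (simp add: add_increasing2)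
next
  case False
  then have "r powr a \<le> r powr t" using assms by (intro powr_mono) auto
  then show ?thesis by simp
qed

section \<open>The error estimate\<close>

text \<open>The grid norm is a maximum, which is only meaningful over a finite set.\<close>
lemma finite_bounded_grid:
  fixes \<Omega> :: "(real^'d) set"
  assumes h: "h > 0" and b: "bounded \<Omega>"
  shows "finite (\<Omega> \<inter> grid h)"
proof -
  obtain R where R: "\<And>x. x \<in> \<Omega> \<Longrightarrow> norm x \<le> R"
    using b by (auto simp: bounded_iff)
  \<comment> \<open>A grid point of norm at most \<open>R\<close> has integer coordinates of modulus at most \<open>R / h\<close>.\<close>
  define K where "K = \<lceil>R / h\<rceil>"
  let ?N = "vec_lambda ` (PiE UNIV (\<lambda>_::'d. {- K..K}))"
  have "\<Omega> \<inter> grid h \<subseteq> (\<lambda>n. h *\<^sub>R of_int_vec n) ` ?N"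
  proof
    fix x assume x: "x \<in> \<Omega> \<inter> grid h"
    then obtain n where n: "x = h *\<^sub>R of_int_vec n"
      by (auto simp: grid_eq)
    have "\<bar>n $ p\<bar> \<le> K" for p
    proof -
      have "\<bar>x $ p\<bar> \<le> R"
        using component_le_norm_cart[of x p] R[of x] x by simp
      then have "h * \<bar>real_of_int (n $ p)\<bar> \<le> R"
        using h by (simp add: n of_int_vec_def abs_mult)
      then have "\<bar>real_of_int (n $ p)\<bar> \<le> R / h"
        using h by (simp add: field_simps)
      then show ?thesis unfolding K_def by linarith
    qed
    then have "n \<in> ?N"
      by (intro image_eqI[of _ _ "vec_nth n"]) (auto simp: abs_le_iff minus_le_iff)
    then show "x \<in> (\<lambda>n. h *\<^sub>R of_int_vec n) ` ?N"
      using n by blast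
  qed
  moreover have "finite ?N"
    by (intro finite_imageI finite_PiE) auto
  ultimately show ?thesis
    by (meson finite_imageI finite_subset)
qed

lemma frac_lap_consistency:
  fixes u :: "real^'d \<Rightarrow> real"
  assumes u: "u \<in> barron t" and h: "h > 0" and x: "x \<in> grid h"
    and a: "0 < \<alpha> x" "\<alpha> x < 2" and s: "0 < s" "s \<le> 2" and t: "\<alpha> x + s \<le> t"
  shows "norm (complex_of_real (frac_lap \<alpha> u x) - frac_lap_h h \<alpha> (restrict u (grid h)) x) \<le>
    1 / (2 * pi) ^ CARD('d) * h powr s * barron_norm t u"
proof -
  define C where "C = 1 / (2 * pi) ^ CARD('d)"
  have C: "C > 0" by (simp add: C_def)
  have cont: "continuous_on UNIV u" and iu: "integrable lborel u"
    and iB: "integrable lborel (\<lambda>\<xi>. (1 + norm \<xi> powr t) * norm (fourier u \<xi>))"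
    using u by (auto simp: barron_def)
  have [measurable]: "u \<in> borel_measurable borel"
    using iu by auto
  have dom: "integrable lborel (\<lambda>\<xi>. norm \<xi> powr b * norm (fourier u \<xi>))" if "0 \<le> b" "b \<le> t" for b
  proof (rule Bochner_Integration.integrable_bound[OF iB])
    show "AE \<xi> in lborel. norm (norm \<xi> powr b * norm (fourier u \<xi>)) \<le> norm ((1 + norm \<xi> powr t) * norm (fourier u \<xi>))"
    proof (intro AE_I2)
      fix \<xi> :: "real^'d"
      have "norm \<xi> powr b * norm (fourier u \<xi>) \<le> (1 + norm \<xi> powr t) * norm (fourier u \<xi>)"
        using that by (intro mult_right_mono powr_le_one_plus_powr) auto
      then show "norm (norm \<xi> powr b * norm (fourier u \<xi>)) \<le> norm ((1 + norm \<xi> powr t) * norm (fourier u \<xi>))"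
        by (simp add: abs_mult)
    qed
  qed measurable
  have F: "integrable lborel (fourier u)"
  proof (rule Bochner_Integration.integrable_bound[OF iB])
    have "1 * norm (fourier u \<xi>) \<le> (1 + norm \<xi> powr t) * norm (fourier u \<xi>)" for \<xi>
      by (intro mult_right_mono) auto
    then show "AE \<xi> in lborel. norm (fourier u \<xi>) \<le> norm ((1 + norm \<xi> powr t) * norm (fourier u \<xi>))"
      by (intro AE_I2) (simp add: abs_mult)
  qed measurable
  have Fa: "integrable lborel (\<lambda>\<xi>. norm \<xi> powr \<alpha> x * norm (fourier u \<xi>))"
    using a s t by (intro dom) auto
  let ?A = "\<lambda>\<xi>. iexp (\<xi> \<bullet> x) * fourier u \<xi> * complex_of_real (norm \<xi> powr \<alpha> x)"
  let ?B = "\<lambda>\<xi>. iexp (\<xi> \<bullet> x) * fourier u \<xi> * complex_of_real (symbol_h h \<xi> powr (\<alpha> x / 2))"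
  have iA: "integrable lborel ?A"
    by (rule Bochner_Integration.integrable_bound[OF Fa]) (auto simp: norm_mult)
  have iB': "integrable lborel ?B"
  proof (rule Bochner_Integration.integrable_bound[OF Fa])
    have "symbol_h h \<xi> powr (\<alpha> x / 2) \<le> norm \<xi> powr \<alpha> x" for \<xi> :: "real^'d"
    proof -
      have "symbol_h h \<xi> powr (\<alpha> x / 2) \<le> ((norm \<xi>)\<^sup>2) powr (\<alpha> x / 2)"
        using symbol_h_bounds[OF h, of \<xi>] a by (intro powr_mono2) auto
      also have "\<dots> = norm \<xi> powr \<alpha> x"
        using powr_powr[of "norm \<xi>" 2 "\<alpha> x / 2"] by (cases "\<xi> = 0") auto
      finally show ?thesis .
    qed
    then show "AE \<xi> in lborel. norm (?B \<xi>) \<le> norm (norm \<xi> powr \<alpha> x * norm (fourier u \<xi>))"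
      by (intro AE_I2) (simp add: norm_mult mult.commute mult_left_mono)
  qed measurable
  have "complex_of_real (frac_lap \<alpha> u x) - frac_lap_h h \<alpha> (restrict u (grid h)) x =
      complex_of_real C * (LINT \<xi>|lborel. ?A \<xi> - ?B \<xi>)"
    unfolding frac_lap_fourier[where \<alpha> = \<alpha> and x = x, OF iu cont F a Fa]
      frac_lap_h_fourier[where \<alpha> = \<alpha> and x = x, OF iu cont F h x a]
      Bochner_Integration.integral_diff[OF iA iB'] C_def
    by (rule right_diff_distrib[symmetric])
  also have "norm \<dots> \<le> C * (LINT \<xi>|lborel. h powr s * ((1 + norm \<xi> powr t) * norm (fourier u \<xi>)))"
    unfolding norm_mult norm_of_real abs_of_pos[OF C]
  proof (intro mult_left_mono Bochner_Integration.integral_norm_bound_integral)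
    fix \<xi> :: "real^'d"
    have "norm (?A \<xi> - ?B \<xi>) = \<bar>norm \<xi> powr \<alpha> x - symbol_h h \<xi> powr (\<alpha> x / 2)\<bar> * norm (fourier u \<xi>)"
      unfolding right_diff_distrib[symmetric] norm_mult of_real_diff[symmetric] norm_of_real by simp
    also have "\<dots> \<le> (h powr s * (1 + norm \<xi> powr t)) * norm (fourier u \<xi>)"
    proof (rule mult_right_mono)
      have "norm \<xi> powr (\<alpha> x + s) \<le> 1 + norm \<xi> powr t"
        using a s t by (intro powr_le_one_plus_powr) auto
      then show "\<bar>norm \<xi> powr \<alpha> x - symbol_h h \<xi> powr (\<alpha> x / 2)\<bar> \<le> h powr s * (1 + norm \<xi> powr t)"
        by (intro order_trans[OF symbol_error[OF h a s]] mult_left_mono) auto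
    qed simp
    finally show "norm (?A \<xi> - ?B \<xi>) \<le> h powr s * ((1 + norm \<xi> powr t) * norm (fourier u \<xi>))"
      by (simp add: mult.assoc)
  qed (use iA iB' iB C in auto)
  finally show ?thesis
    unfolding barron_norm_def C_def by (simp add: mult.assoc)
qed

theorem theorem2p3:
  fixes \<alpha> :: "real^'d \<Rightarrow> real" and \<alpha>min \<alpha>max s :: real and \<Omega> :: "(real^'d) set"
  assumes "continuous_on UNIV \<alpha>"
    and "0 < \<alpha>min" and "\<And>x. \<alpha>min \<le> \<alpha> x" and "\<And>x. \<alpha> x \<le> \<alpha>max" and "\<alpha>max < 2"
    and "0 < s" and "s \<le> 2"
    and "open \<Omega>" and "connected \<Omega>" and "\<Omega> \<noteq> {}" and "bounded \<Omega>"
  shows "\<exists>c::real. \<forall>h>0. \<forall>u\<in>barron (s + \<alpha>max).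
    grid_max_norm h \<Omega>
      (\<lambda>x. complex_of_real (frac_lap \<alpha> u x) - frac_lap_h h \<alpha> (restrict u (grid h)) x)
    \<le> c * h powr s * barron_norm (s + \<alpha>max) u"
proof (intro exI[of _ "1 / (2 * pi) ^ CARD('d)"] allI impI ballI)
  fix h :: real and u :: "real^'d \<Rightarrow> real"
  assume h: "h > 0" and u: "u \<in> barron (s + \<alpha>max)"
  let ?e = "\<lambda>x. complex_of_real (frac_lap \<alpha> u x) - frac_lap_h h \<alpha> (restrict u (grid h)) x"
  let ?c = "1 / (2 * pi) ^ CARD('d) * h powr s * barron_norm (s + \<alpha>max) u"
  have pt: "norm (?e x) \<le> ?c" if "x \<in> \<Omega> \<inter> grid h" for x
  proof (rule frac_lap_consistency[OF u h])
    show "0 < \<alpha> x" "\<alpha> x < 2" "\<alpha> x + s \<le> s + \<alpha>max"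
      using assms(2) assms(3,4)[of x] assms(5) by linarith+
  qed (use that assms in auto)
  show "grid_max_norm h \<Omega> ?e \<le> ?c"
  proof (cases "\<Omega> \<inter> grid h = {}")
    case True
    have "barron_norm (s + \<alpha>max) u \<ge> 0"
      unfolding barron_norm_def by (intro Bochner_Integration.integral_nonneg) simp
    then show ?thesis using True by (simp add: grid_max_norm_def)
  next
    case False
    have "Max ((\<lambda>x. norm (?e x)) ` (\<Omega> \<inter> grid h)) \<le> ?c"
      using False pt finite_bounded_grid[OF h assms(11)] by (subst Max_le_iff) auto
    then show ?thesis using False by (simp add: grid_max_norm_def)
  qed
qed

end
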